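(* Let $a,b,c$ be positive integers with $b\le c$. Consider $a$ simple symmetric random walks (each step $\pm1$) on $\mathbb{Z}$, the $j$-th one ($0\le j\le a-1$) starting at position $2j$ at time $0$ and ending at position $c-b+2j$ at time $b+c$, conditioned never to intersect during $[0,b+c]$ (so the path families are chosen uniformly among all non-intersecting families with these endpoints). Equivalently, writing $z^r=(z^r_0<\dots<z^r_{a-1})\in\mathbb{Z}^a$ for the particle positions at time $r$, with $z^0_j=2j$ and $z^{b+c}_j=c-b+2j$, the configuration $(z^1,\dots,z^{b+c-1})$ has probability $$p(\underline z)=\frac{1}{Z(a,b,c)}\prod_{r=0}^{b+c-1}\det\big(\phi(z^r_j,z^{r+1}_k)\big)_{j,k=0}^{a-1},\qquad \phi(x,y)=\delta_{x-1,y}+\delta_{x+1,y},$$ where $Z(a,b,c)$ is the normalizing constant. Then this point process (the set of all pairs $(r,z^r_j)$, $0<r<b+c$, $0\le j\le a-1$) is determinantal: for any distinct points $(r_1,u_1),\dots,(r_k,u_k)$ with $0<r_i<b+c$, $u_i\in\mathbb{Z}$, the probability that for every $i$ there is a particle at position $u_i$ at time $r_i$ equals $\det\big(K_H(r_i,u_i;r_j,u_j)\big)_{i,j=1}^k$, where the kernel $K_H$ is given, for $0<r,s<b+c$ and $x,y\in\mathbb{Z}$, by $$K_H(r,\alpha_r+2x;s,\alpha_s+2y)=-\phi_{r,s}(\alpha_r+2x,\alpha_s+2y)+\sum_{n=0}^{a-1}\sqrt{\frac{(a+s-1-n)!\,(a+b+c-r-1-n)!}{(a+r-1-n)!\,(a+b+c-s-1-n)!}}\;q^{(b_r,a_r)}_{n,\gamma_r}(x)\,q^{(b_s,a_s)}_{n,\gamma_s}(y)\,\omega_r(x)\,\tilde\omega_s(y),$$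 with $\phi_{r,s}\equiv0$ if $r\ge s$ and $\phi_{r,s}(x,y)=\binom{s-r}{\frac{y-x+s-r}{2}}$ if $r<s$ (the number of $\pm1$ paths from $x$ to $y$ in $s-r$ steps). (Positions $u$ at time $r$ with $u\not\equiv r \pmod 2$ are never occupied; every position of parity $r$ is of the form $\alpha_r+2x$.)
   Context: Notation: $(t)_n=t(t+1)\cdots(t+n-1)$, $(t)_0=1$; convention $1/m!=0$ for negative integers $m$; binomial coefficients are zero when the lower index is not an integer in $[0,s-r]$. For $0\le r\le b+c$ set $a_r=|c-r|$, $b_r=|b-r|$, $\alpha_r=-r$ for $0\le r\le b$ and $\alpha_r=r-2b$ for $b\le r\le b+c$; $\gamma_r=r+a-1$ for $0\le r\le b$, $\gamma_r=b+a-1$ for $b\le r\le c$, $\gamma_r=a+b+c-1-r$ for $c\le r\le b+c$. Weights: $\omega_r(x)=((b_r+x)!(\gamma_r+a_r-x)!)^{-1}$ for $0\le r\le b$; $(x!(\gamma_r+a_r-x)!)^{-1}$ for $b\le r\le c$; $(x!(\gamma_r-x)!)^{-1}$ for $c\le r\le b+c$. And $\tilde\omega_s(y)=(y!(\gamma_s-y)!)^{-1}$ for $0\le s\le b$; $((b_s+y)!(\gamma_s-y)!)^{-1}$ for $b\le s\le c$; $((b_s+y)!(\gamma_s+a_s-y)!)^{-1}$ for $c\le s\le b+c$. Normalized associated Hahn polynomials: for integers $\alpha,\beta\ge0$, $N\ge0$, $0\le n\le N$, $$q^{(\alpha,\beta)}_{n,N}(x)=\frac{(-N-\beta)_n(-N)_n}{d^{(\alpha,\beta)}_{n,N}\,n!}\sum_{j=0}^n\binom{n}{j}(-1)^j\frac{(-x)_j\,(n-2N-\alpha-\beta-1)_j}{(-N-\beta)_j\,(-N)_j},$$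 where $d^{(\alpha,\beta)}_{n,N}>0$ is given by $$\big(d^{(\alpha,\beta)}_{n,N}\big)^2=\frac{(\alpha+\beta+N+1-n)_{N+1}}{(\alpha+\beta+2N+1-2n)\,n!\,(\beta+N-n)!\,(\alpha+N-n)!\,(N-n)!}.$$ These are orthonormal on $\{0,\dots,N\}$ with respect to the weight $w(x)=\big(x!(x+\alpha)!(N+\beta-x)!(N-x)!\big)^{-1}$. *)

theory Defs
  imports Complex_Main "Jordan_Normal_Form.Determinant"
begin

text \<open>A family is z r j = position of particle j at time r (r = 0..b+c, j = 0..a-1);
  outside this index range z is normalised to 0 so that the set of families is finite.\<close>

definition nip_families :: "nat \<Rightarrow> nat \<Rightarrow> nat \<Rightarrow> (nat \<Rightarrow> nat \<Rightarrow> int) set" where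
  "nip_families a b c = {z.
     (\<forall>r j. (b + c < r \<or> a \<le> j) \<longrightarrow> z r j = 0) \<and>
     (\<forall>j<a. z 0 j = 2 * int j \<and> z (b + c) j = int c - int b + 2 * int j) \<and>
     (\<forall>r<b + c. \<forall>j<a. \<bar>z (Suc r) j - z r j\<bar> = 1) \<and>
     (\<forall>r\<le>b + c. \<forall>j. Suc j < a \<longrightarrow> z r j < z r (Suc j))}"

definition corr_prob :: "nat \<Rightarrow> nat \<Rightarrow> nat \<Rightarrow> nat \<Rightarrow> (nat \<Rightarrow> nat \<times> int) \<Rightarrow> real" where
  "corr_prob a b c k p =
     real (card {z \<in> nip_families a b c. \<forall>i<k. \<exists>j<a. z (fst (p i)) j = snd (p i)})
     / real (card (nip_families a b c))"

definition inv_fact :: "int \<Rightarrow> real" where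
  "inv_fact m = (if m < 0 then 0 else 1 / fact (nat m))"

definition a_r :: "nat \<Rightarrow> nat \<Rightarrow> nat \<Rightarrow> nat \<Rightarrow> nat" where
  "a_r a b c r = nat \<bar>int c - int r\<bar>"

definition b_r :: "nat \<Rightarrow> nat \<Rightarrow> nat \<Rightarrow> nat \<Rightarrow> nat" where
  "b_r a b c r = nat \<bar>int b - int r\<bar>"

definition alpha_r :: "nat \<Rightarrow> nat \<Rightarrow> nat \<Rightarrow> nat \<Rightarrow> int" where
  "alpha_r a b c r = (if r \<le> b then - int r else int r - 2 * int b)"

definition gamma_r :: "nat \<Rightarrow> nat \<Rightarrow> nat \<Rightarrow> nat \<Rightarrow> int" where
  "gamma_r a b c r =
     (if r \<le> b then int r + int a - 1
      else if r \<le> c then int b + int a - 1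
      else int a + int b + int c - 1 - int r)"

definition omega_r :: "nat \<Rightarrow> nat \<Rightarrow> nat \<Rightarrow> nat \<Rightarrow> int \<Rightarrow> real" where
  "omega_r a b c r x =
     (let g = gamma_r a b c r; ar = int (a_r a b c r); br = int (b_r a b c r) in
      if r \<le> b then inv_fact (br + x) * inv_fact (g + ar - x)
      else if r \<le> c then inv_fact x * inv_fact (g + ar - x)
      else inv_fact x * inv_fact (g - x))"

definition omega_tilde :: "nat \<Rightarrow> nat \<Rightarrow> nat \<Rightarrow> nat \<Rightarrow> int \<Rightarrow> real" where
  "omega_tilde a b c s y =
     (let g = gamma_r a b c s; as = int (a_r a b c s); bs = int (b_r a b c s) in
      if s \<le> b then inv_fact y * inv_fact (g - y)
      else if s \<le> c then inv_fact (bs + y) * inv_fact (g - y)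
      else inv_fact (bs + y) * inv_fact (g + as - y))"

definition hahn_d :: "nat \<Rightarrow> nat \<Rightarrow> nat \<Rightarrow> nat \<Rightarrow> real" where
  "hahn_d al be n N = sqrt (
     pochhammer (real al + real be + real N + 1 - real n) (N + 1) /
     ((real al + real be + 2 * real N + 1 - 2 * real n) * fact n * fact (be + N - n)
       * fact (al + N - n) * fact (N - n)))"

definition hahn_q :: "nat \<Rightarrow> nat \<Rightarrow> nat \<Rightarrow> nat \<Rightarrow> real \<Rightarrow> real" where
  "hahn_q al be n N x =
     pochhammer (- real N - real be) n * pochhammer (- real N) n / (hahn_d al be n N * fact n) *
     (\<Sum>j=0..n. real (n choose j) * (-1) ^ j *
        (pochhammer (- x) j * pochhammer (real n - 2 * real N - real al - real be - 1) j) /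
        (pochhammer (- real N - real be) j * pochhammer (- real N) j))"

definition binom_half :: "nat \<Rightarrow> int \<Rightarrow> real" where
  "binom_half m q = (if even q \<and> 0 \<le> q div 2 \<and> q div 2 \<le> int m
                     then real (m choose nat (q div 2)) else 0)"

definition phi_rs :: "nat \<Rightarrow> nat \<Rightarrow> int \<Rightarrow> int \<Rightarrow> real" where
  "phi_rs r s u v = (if s \<le> r then 0 else binom_half (s - r) (v - u + int (s - r)))"

text \<open>K_H(r,u;s,v); for u = alpha_r + 2x and v = alpha_s + 2y this is the formula of the
  paper; at positions of the wrong parity (never occupied) it is set to 0.\<close>
definition K_H :: "nat \<Rightarrow> nat \<Rightarrow> nat \<Rightarrow> nat \<Rightarrow> int \<Rightarrow> nat \<Rightarrow> int \<Rightarrow> real" where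
  "K_H a b c r u s v =
     (if even (u - alpha_r a b c r) \<and> even (v - alpha_r a b c s) then
       (let x = (u - alpha_r a b c r) div 2; y = (v - alpha_r a b c s) div 2 in
        - phi_rs r s u v +
        (\<Sum>n<a. sqrt (fact (a + s - 1 - n) * fact (a + b + c - r - 1 - n) /
                       (fact (a + r - 1 - n) * fact (a + b + c - s - 1 - n)))
           * hahn_q (b_r a b c r) (a_r a b c r) n (nat (gamma_r a b c r)) (real_of_int x)
           * hahn_q (b_r a b c s) (a_r a b c s) n (nat (gamma_r a b c s)) (real_of_int y)
           * omega_r a b c r x * omega_tilde a b c s y))
      else 0)"

end

theory Submission
  imports Defs
begin

text \<open>Let \<open>A\<close> be the matrix of path counts from the start to the end points. The number of
  non-intersecting families avoiding a set of points is the determinant of the corresponding matrix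
  of path counts, which differs from \<open>A\<close> by a matrix of rank at most \<open>k\<close>; inclusion-exclusion over
  the given points then yields \<open>det K\<close> with \<open>K = H A\<inverse> G - \<phi>\<close>. To make \<open>A\<inverse>\<close> explicit, note that the Hahn
  functions \<open>q\<^sub>n \<omega>~\<^sub>s\<close> are carried forward and \<open>q\<^sub>n \<omega>\<^sub>r\<close> backward by the walk, up to factors, and that
  at the initial (final) time they are supported on the start (end) points. Since the pairing of the
  two families does not depend on the time, the orthogonality relation at time \<open>0\<close> suffices.\<close>

section \<open>Non-intersecting walks and determinants\<close>

text \<open>Inclusion-exclusion is needed because avoiding a set of points is a product of
  one-particle weights, to which the determinant formula applies, whereas hitting a point is not.
  The rank-\<open>k\<close> correction naturally involves walks that reach a point without meeting
  the set before. Replacing them by all walks multiplies by \<open>1 + P\<close>, where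
  \<open>P\<close> counts walks between the points; this is the origin of the term -\<phi>, and the
  factor has determinant 1 because walks strictly increase time. The obstacle on the Hahn side is
  that weights and parameters change form at times \<open>b\<close> and \<open>c\<close>. With real
  parameters A = N + \<beta>, B = N and S = 2N + \<alpha> + \<beta> + 1 the unnormalised polynomials
  are symmetric in A and B, have no denominators in them, and a time step moves one of A, B by one
  while S stays fixed. The factorials in \<open>hexE\<close> and \<open>hexF\<close> absorb the
  constants of the contiguity relations, so both satisfy the walk recursion exactly; the square root
  of the kernel is what turns the normalisations \<open>hahn_d\<close> back into these factorials.
  The convention 1/m! = 0 for negative m makes the recursions hold on all of Z without boundary
  terms.\<close>

lemma det_mat_leibniz:
  fixes F :: "nat \<Rightarrow> nat \<Rightarrow> 'a::comm_ring_1"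
  shows "det (mat k k (\<lambda>(i, j). F i j)) =
    (\<Sum>p | p permutes {..<k}. signof p * (\<Prod>i<k. F i (p i)))"
proof -
  have "det (mat k k (\<lambda>(i, j). F i j)) =
      (\<Sum>p | p permutes {0..<k}. signof p * (\<Prod>i = 0..<k. mat k k (\<lambda>(i, j). F i j) $$ (i, p i)))"
    by (rule det_def') simp
  also have "\<dots> = (\<Sum>p | p permutes {0..<k}. signof p * (\<Prod>i = 0..<k. F i (p i)))"
  proof (rule sum.cong[OF refl])
    fix p assume "p \<in> {p. p permutes {0..<k}}"
    then have "p i < k" if "i < k" for i using that permutes_in_image[of p "{0..<k}" i] by simp
    then have "(\<Prod>i = 0..<k. mat k k (\<lambda>(i, j). F i j) $$ (i, p i)) = (\<Prod>i = 0..<k. F i (p i))"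
      by (intro prod.cong) simp_all
    then show "signof p * (\<Prod>i = 0..<k. mat k k (\<lambda>(i, j). F i j) $$ (i, p i)) =
      signof p * (\<Prod>i = 0..<k. F i (p i))" by simp
  qed
  finally show ?thesis by (simp add: atLeast0LessThan)
qed

text \<open>Written as one product over \<open>A\<close>, so that Leibniz terms recombine into a
  determinant whose rows are selected by \<open>I\<close>. The same expansion later gives
  inclusion-exclusion.\<close>

lemma prod_add_if:
  fixes f g :: "'b \<Rightarrow> 'a::comm_ring_1"
  assumes "finite A"
  shows "(\<Prod>x\<in>A. f x + g x) = (\<Sum>I\<in>Pow A. \<Prod>x\<in>A. if x \<in> I then f x else g x)"
  unfolding prod_add[OF assms]
proof (intro sum.cong refl)
  fix I assume "I \<in> Pow A"
  then have "A \<inter> {x. x \<in> I} = I" "A \<inter> - {x. x \<in> I} = A - I" by auto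
  then show "prod f I * prod g (A - I) = (\<Prod>x\<in>A. if x \<in> I then f x else g x)"
    using assms by (simp add: prod.If_cases)
qed

lemma det_mat_add_rows:
  fixes f g :: "nat \<Rightarrow> nat \<Rightarrow> 'a::comm_ring_1"
  shows "det (mat k k (\<lambda>(i, j). f i j + g i j)) =
    (\<Sum>I\<in>Pow {..<k}. det (mat k k (\<lambda>(i, j). if i \<in> I then f i j else g i j)))"
  unfolding det_mat_leibniz
  by (subst prod_add_if, simp, subst sum_distrib_left, rule sum.swap)

lemma det_mat_scale_rows:
  fixes f :: "nat \<Rightarrow> nat \<Rightarrow> 'a::comm_ring_1"
  shows "det (mat k k (\<lambda>(i, j). c i * f i j)) = (\<Prod>i<k. c i) * det (mat k k (\<lambda>(i, j). f i j))"
  unfolding det_mat_leibniz by (simp add: prod.distrib sum_distrib_left ac_simps)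

lemma det_mat_equal_rows:
  fixes f :: "nat \<Rightarrow> nat \<Rightarrow> 'a::comm_ring_1"
  assumes "i < k" "i' < k" "i \<noteq> i'" "\<And>j. j < k \<Longrightarrow> f i j = f i' j"
  shows "det (mat k k (\<lambda>(i, j). f i j)) = 0"
  by (rule det_identical_rows[of _ k i i']) (use assms in \<open>auto simp: row_def\<close>)

text \<open>The weight of the final position is not counted.\<close>

fun walk_wt :: "(nat \<Rightarrow> int \<Rightarrow> real) \<Rightarrow> nat \<Rightarrow> int \<Rightarrow> int \<Rightarrow> real" where
  "walk_wt w 0 v u = of_bool (u = v)"
| "walk_wt w (Suc r) v u = w r (u - 1) * walk_wt w r v (u - 1) + w r (u + 1) * walk_wt w r v (u + 1)"

text \<open>Generalises \<open>nip_families\<close> to an arbitrary final time and arbitrary end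
  points, as the induction on time requires.\<close>

definition nip_to :: "nat \<Rightarrow> nat \<Rightarrow> (nat \<Rightarrow> int) \<Rightarrow> (nat \<Rightarrow> nat \<Rightarrow> int) set" where
  "nip_to a T y = {z.
     (\<forall>r j. (T < r \<or> a \<le> j) \<longrightarrow> z r j = 0) \<and>
     (\<forall>j<a. z 0 j = 2 * int j \<and> z T j = y j) \<and>
     (\<forall>r<T. \<forall>j<a. \<bar>z (Suc r) j - z r j\<bar> = 1) \<and>
     (\<forall>r\<le>T. \<forall>j. Suc j < a \<longrightarrow> z r j < z r (Suc j))}"

lemma nip_to_beyond: "z \<in> nip_to a T y \<Longrightarrow> T < r \<or> a \<le> j \<Longrightarrow> z r j = 0"
  unfolding nip_to_def by blast

lemma nip_to_0:
  assumes "\<And>j. a \<le> j \<Longrightarrow> y j = 0"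
  shows "nip_to a 0 y =
    (if \<forall>j<a. y j = 2 * int j then {\<lambda>r j. if r = 0 \<and> j < a then 2 * int j else 0} else {})"
proof -
  have "z = (\<lambda>r j. if r = 0 \<and> j < a then 2 * int j else 0)" if "z \<in> nip_to a 0 y" for z
    using that by (intro ext) (auto simp: nip_to_def not_less)
  moreover have "\<forall>j<a. y j = 2 * int j" if "z \<in> nip_to a 0 y" for z
    using that by (auto simp: nip_to_def)
  moreover have "(\<lambda>r j. if r = 0 \<and> j < a then 2 * int j else 0) \<in> nip_to a 0 y"
    if "\<forall>j<a. y j = 2 * int j"
    using that by (auto simp: nip_to_def)
  ultimately show ?thesis by auto
qed

lemma permutes_mono_eq_id:
  assumes p: "p permutes {..<a}" and mono: "\<And>k. Suc k < a \<Longrightarrow> p k \<le> p (Suc k)"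
  shows "p = id"
proof (rule permutes_natset_ge[OF p])
  have "k < a \<Longrightarrow> k \<le> p k" for k
  proof (induction k)
    case (Suc k)
    then have "k \<le> p k" "p k \<le> p (Suc k)" using mono by auto
    moreover have "p k \<noteq> p (Suc k)" using permutes_inj[OF p] by (simp add: inj_eq)
    ultimately show ?case by simp
  qed simp
  then show "\<forall>i\<in>{..<a}. i \<le> p i" by simp
qed

text \<open>A permutation other than the identity decreases at some neighbouring pair
  \<open>k\<close>, \<open>Suc k\<close>. A nonzero Leibniz term would then force
  \<open>y k > y (Suc k)\<close>, so only the identity contributes.\<close>

lemma det_start:
  fixes y :: "nat \<Rightarrow> int"
  assumes "\<And>j. Suc j < a \<Longrightarrow> y j \<le> y (Suc j)"
  shows "det (mat a a (\<lambda>(k, i). of_bool (y k = 2 * int i) :: real)) =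
    of_bool (\<forall>j<a. y j = 2 * int j)"
proof -
  have "(\<Prod>k<a. of_bool (y k = 2 * int (p k)) :: real) = 0" if "p permutes {..<a}" "p \<noteq> id" for p
  proof -
    from permutes_mono_eq_id[OF that(1)] that(2) obtain k where k: "Suc k < a" "\<not> p k \<le> p (Suc k)"
      by blast
    then have "\<not> (y k = 2 * int (p k) \<and> y (Suc k) = 2 * int (p (Suc k)))"
      using assms[of k] by auto
    then have "\<exists>i\<in>{..<a}. (of_bool (y i = 2 * int (p i)) :: real) = 0"
      using k(1) by (cases "y k = 2 * int (p k)") (auto intro: bexI[of _ k] bexI[of _ "Suc k"])
    then show ?thesis by (simp add: prod_zero_iff)
  qed
  then have "det (mat a a (\<lambda>(k, i). of_bool (y k = 2 * int i) :: real)) =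
      (\<Sum>p\<in>{id}. signof p * (\<Prod>k<a. of_bool (y k = 2 * int (p k))))"
    unfolding det_mat_leibniz
    by (intro sum.mono_neutral_right) (auto simp: permutes_id finite_permutations)
  also have "\<dots> = of_bool (\<forall>j<a. y j = 2 * int j)"
    by (auto simp: prod_zero_iff)
  finally show ?thesis .
qed

text \<open>\<open>e\<close> is the set of particles whose last step goes down. The value 0 from
  index \<open>a\<close> on matches the normalisation of families.\<close>

definition prev_pos :: "nat \<Rightarrow> (nat \<Rightarrow> int) \<Rightarrow> nat set \<Rightarrow> nat \<Rightarrow> int" where
  "prev_pos a y e j = (if j < a then y j + (if j \<in> e then 1 else - 1) else 0)"

lemma prev_pos_inj:
  assumes "prev_pos a y e = prev_pos a y e'" "e \<subseteq> {..<a}" "e' \<subseteq> {..<a}"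
  shows "e = e'"
proof -
  have "j \<in> e \<longleftrightarrow> j \<in> e'" if "j < a" for j
    using fun_cong[OF assms(1), of j] that by (auto simp: prev_pos_def split: if_splits)
  then show ?thesis using assms(2,3) by auto
qed

text \<open>Families are classified by their row at time \<open>T\<close>. Some choices of
  \<open>e\<close> may make previous positions coincide; the corresponding sets are then simply
  empty.\<close>

lemma nip_to_Suc:
  assumes y0: "\<And>j. a \<le> j \<Longrightarrow> y j = 0" and strict: "\<And>j. Suc j < a \<Longrightarrow> y j < y (Suc j)"
  shows "nip_to a (Suc T) y = (\<Union>e\<in>Pow {..<a}. (\<lambda>z. z(Suc T := y)) ` nip_to a T (prev_pos a y e))"
    (is "?L = ?R")
proof (intro equalityI subsetI)
  fix z assume z: "z \<in> ?L"
  then have supp: "\<And>r j. Suc T < r \<or> a \<le> j \<Longrightarrow> z r j = 0"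
    and ends: "\<And>j. j < a \<Longrightarrow> z 0 j = 2 * int j" "\<And>j. j < a \<Longrightarrow> z (Suc T) j = y j"
    and steps: "\<And>r j. r < Suc T \<Longrightarrow> j < a \<Longrightarrow> \<bar>z (Suc r) j - z r j\<bar> = 1"
    and incr: "\<And>r j. r \<le> Suc T \<Longrightarrow> Suc j < a \<Longrightarrow> z r j < z r (Suc j)"
    unfolding nip_to_def by blast+
  define e where "e = {j. j < a \<and> z T j = y j + 1}"
  have zT: "z T j = prev_pos a y e j" for j
  proof (cases "j < a")
    case True
    then have "\<bar>y j - z T j\<bar> = 1" using steps[of T j] ends(2)[of j] by simp
    then show ?thesis using True by (auto simp: prev_pos_def e_def)
  qed (use supp[of T j] in \<open>auto simp: prev_pos_def\<close>)
  have zy: "z (Suc T) = y"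
  proof
    fix j show "z (Suc T) j = y j" using ends(2)[of j] supp[of "Suc T" j] y0[of j] by (cases "j < a") auto
  qed
  have "z(Suc T := (\<lambda>_. 0)) \<in> nip_to a T (prev_pos a y e)"
    unfolding nip_to_def using supp ends(1) zT steps incr by simp
  moreover have "z = (z(Suc T := (\<lambda>_. 0)))(Suc T := y)" using zy by (simp add: fun_upd_idem)
  moreover have "e \<in> Pow {..<a}" by (auto simp: e_def)
  ultimately show "z \<in> ?R" by blast
next
  fix z' assume "z' \<in> ?R"
  then obtain e z where z: "z \<in> nip_to a T (prev_pos a y e)" and z': "z' = z(Suc T := y)" by auto
  from z have supp: "\<And>r j. T < r \<or> a \<le> j \<Longrightarrow> z r j = 0"
    and ends: "\<And>j. j < a \<Longrightarrow> z 0 j = 2 * int j" "\<And>j. j < a \<Longrightarrow> z T j = prev_pos a y e j"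
    and steps: "\<And>r j. r < T \<Longrightarrow> j < a \<Longrightarrow> \<bar>z (Suc r) j - z r j\<bar> = 1"
    and incr: "\<And>r j. r \<le> T \<Longrightarrow> Suc j < a \<Longrightarrow> z r j < z r (Suc j)"
    unfolding nip_to_def by blast+
  have last: "\<bar>y j - z T j\<bar> = 1" if "j < a" for j
    using that ends(2) by (auto simp: prev_pos_def)
  show "z' \<in> ?L"
    unfolding z' nip_to_def
  proof (intro CollectI conjI allI impI)
    fix r j
    show "(z(Suc T := y)) r j = 0" if "Suc T < r \<or> a \<le> j" using that supp[of r j] y0[of j] by auto
    show "\<bar>(z(Suc T := y)) (Suc r) j - (z(Suc T := y)) r j\<bar> = 1" if "r < Suc T" "j < a"
      using that steps[of r j] last[of j] by (cases "r = T") auto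
    show "(z(Suc T := y)) r j < (z(Suc T := y)) r (Suc j)" if "r \<le> Suc T" "Suc j < a"
      using that incr[of r j] strict[of j] by (cases "r = Suc T") auto
  qed (use ends(1) in auto)
qed

text \<open>No path switching is needed: the recursion for weakly increasing end points
  is multilinearity of the determinant, and coinciding end points give equal rows.\<close>

lemma sum_nip_to_eq_det:
  assumes "\<And>j. a \<le> j \<Longrightarrow> y j = 0" and "\<And>j. Suc j < a \<Longrightarrow> y j \<le> y (Suc j)"
    and "\<And>j. j < a \<Longrightarrow> even (y j - int T)"
  shows "finite (nip_to a T y) \<and>
    (\<Sum>z\<in>nip_to a T y. \<Prod>r<T. \<Prod>j<a. w r (z r j)) =
    det (mat a a (\<lambda>(k, i). walk_wt w T (2 * int i) (y k)))"
  using assms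
proof (induction T arbitrary: y)
  case 0
  then show ?case by (subst (1 2) nip_to_0) (auto simp: det_start)
next
  case (Suc T)
  show ?case
  proof (cases "\<forall>j. Suc j < a \<longrightarrow> y j < y (Suc j)")
    case False
    then obtain j where j: "Suc j < a" "y j = y (Suc j)" using Suc.prems(2) by force
    have "nip_to a (Suc T) y = {}"
    proof (intro equals0I)
      fix z assume z: "z \<in> nip_to a (Suc T) y"
      then have "z (Suc T) j < z (Suc T) (Suc j)" using j(1) by (auto simp only: nip_to_def)
      moreover have "z (Suc T) j = y j" "z (Suc T) (Suc j) = y (Suc j)"
        using z j(1) by (auto simp: nip_to_def)
      ultimately show False using j(2) by simp
    qed
    moreover have "det (mat a a (\<lambda>(k, i). walk_wt w (Suc T) (2 * int i) (y k))) = 0"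
      using j by (intro det_mat_equal_rows[of j _ "Suc j"]) auto
    ultimately show ?thesis by simp
  next
    case True
    let ?x = "prev_pos a y" and ?D = "\<lambda>y. det (mat a a (\<lambda>(k, i). walk_wt w T (2 * int i) (y k)))"
    have IH: "finite (nip_to a T (?x e))"
      "(\<Sum>z\<in>nip_to a T (?x e). \<Prod>r<T. \<Prod>j<a. w r (z r j)) = ?D (?x e)" for e
    proof -
      \<comment> \<open>Equal parities turn a strict gap into a gap of at least 2, so one step of
        each particle can at worst make neighbours meet. This is why weakly increasing end points
        suffice in the induction.\<close>
      have "?x e j \<le> ?x e (Suc j)" if "Suc j < a" for j
      proof -
        have "even (y j - int (Suc T))" "even (y (Suc j) - int (Suc T))"
          using that by (intro Suc.prems(3); simp)+
        then have "even (y (Suc j) - y j)" by presburger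
        moreover have "y j < y (Suc j)" using True that by simp
        ultimately have "y j + 2 \<le> y (Suc j)" by presburger
        then show ?thesis using that by (auto simp: prev_pos_def)
      qed
      moreover have "even (?x e j - int T)" if "j < a" for j
        using Suc.prems(3)[OF that] that by (auto simp: prev_pos_def)
      moreover have "?x e j = 0" if "a \<le> j" for j using that by (simp add: prev_pos_def)
      ultimately show "finite (nip_to a T (?x e))"
        "(\<Sum>z\<in>nip_to a T (?x e). \<Prod>r<T. \<Prod>j<a. w r (z r j)) = ?D (?x e)"
        using Suc.IH[of "?x e"] by blast+
    qed
    have U: "nip_to a (Suc T) y = (\<Union>e\<in>Pow {..<a}. (\<lambda>z. z(Suc T := y)) ` nip_to a T (?x e))"
      using Suc.prems(1) True by (intro nip_to_Suc) auto
    have zT: "z T = ?x e" if "z \<in> nip_to a T (?x e)" for z e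
    proof
      fix j
      have "z T j = ?x e j" if "j < a" using \<open>z \<in> _\<close> that unfolding nip_to_def by blast
      moreover have "z T j = 0" if "a \<le> j" using \<open>z \<in> _\<close> that unfolding nip_to_def by blast
      ultimately show "z T j = ?x e j" by (auto simp: prev_pos_def)
    qed
    \<comment> \<open>The overwritten row is identically zero in a family that ends at time
      \<open>T\<close>, hence nothing is lost.\<close>
    have inj: "inj_on (\<lambda>z. z(Suc T := y)) (nip_to a T x)" for x
    proof (rule inj_onI)
      fix z z' assume "z \<in> nip_to a T x" "z' \<in> nip_to a T x" and eq: "z(Suc T := y) = z'(Suc T := y)"
      then have "z (Suc T) j = 0" "z' (Suc T) j = 0" for j by (simp_all add: nip_to_beyond)
      then have "z (Suc T) = z' (Suc T)" by auto
      then show "z = z'" using eq by (metis fun_upd_triv fun_upd_upd)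
    qed
    have "(\<Sum>z\<in>nip_to a (Suc T) y. \<Prod>r<Suc T. \<Prod>j<a. w r (z r j)) =
        (\<Sum>e\<in>Pow {..<a}. \<Sum>z\<in>(\<lambda>z. z(Suc T := y)) ` nip_to a T (?x e). \<Prod>r<Suc T. \<Prod>j<a. w r (z r j))"
      unfolding U
    proof (intro sum.UNION_disjoint ballI impI)
      fix e e' assume e: "e \<in> Pow {..<a}" "e' \<in> Pow {..<a}" "e \<noteq> e'"
      show "(\<lambda>z. z(Suc T := y)) ` nip_to a T (?x e) \<inter> (\<lambda>z. z(Suc T := y)) ` nip_to a T (?x e') = {}"
      proof (rule ccontr)
        assume "\<not> ?thesis"
        then obtain z z' where z: "z \<in> nip_to a T (?x e)" "z' \<in> nip_to a T (?x e')"
          "z(Suc T := y) = z'(Suc T := y)" by blast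
        have "z T = z' T" using fun_cong[OF z(3), of T] by simp
        then have "?x e = ?x e'" using zT z(1,2) by metis
        then show False using prev_pos_inj e by blast
      qed
    qed (auto simp: IH)
    also have "\<dots> = (\<Sum>e\<in>Pow {..<a}. \<Sum>z\<in>nip_to a T (?x e).
        (\<Prod>r<T. \<Prod>j<a. w r (z r j)) * (\<Prod>j<a. w T (?x e j)))"
      by (rule sum.cong[OF refl]) (simp add: sum.reindex[OF inj] zT)
    also have "\<dots> = (\<Sum>e\<in>Pow {..<a}. (\<Prod>j<a. w T (?x e j)) * ?D (?x e))"
      by (rule sum.cong[OF refl], subst sum_distrib_right[symmetric], subst IH(2), rule mult.commute)
    \<comment> \<open>The weights at time \<open>T\<close> are absorbed into the rows. Each row then
      is one of the two summands of \<open>walk_wt\<close> at \<open>Suc T\<close>, and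
      multilinearity adds them up.\<close>
    also have "\<dots> = (\<Sum>e\<in>Pow {..<a}. det (mat a a (\<lambda>(k, i). if k \<in> e
        then w T (y k + 1) * walk_wt w T (2 * int i) (y k + 1)
        else w T (y k - 1) * walk_wt w T (2 * int i) (y k - 1))))"
      by (rule sum.cong[OF refl], subst det_mat_scale_rows[symmetric],
        intro arg_cong[where f = det] eq_matI) (auto simp: prev_pos_def)
    also have "\<dots> = det (mat a a (\<lambda>(k, i). walk_wt w (Suc T) (2 * int i) (y k)))"
      by (subst det_mat_add_rows[symmetric]) (simp add: add.commute)
    finally have "(\<Sum>z\<in>nip_to a (Suc T) y. \<Prod>r<Suc T. \<Prod>j<a. w r (z r j)) =
      det (mat a a (\<lambda>(k, i). walk_wt w (Suc T) (2 * int i) (y k)))" .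
    moreover have "finite (nip_to a (Suc T) y)" unfolding U using IH(1) by (intro finite_UN_I finite_imageI) simp_all
    ultimately show ?thesis by simp
  qed
qed

section \<open>Walks avoiding a finite set of points\<close>

text \<open>Counts walks of \<open>m\<close> steps with displacement \<open>d\<close>: such a walk
  has (d + m)/2 up-steps. Unlike \<open>phi_rs\<close> at equal times, it is the identity for
  \<open>m = 0\<close>.\<close>

definition path_count :: "nat \<Rightarrow> int \<Rightarrow> real" where
  "path_count m d = binom_half m (d + int m)"

lemma path_count_0: "path_count 0 d = of_bool (d = 0)"
  by (auto simp: path_count_def binom_half_def)

lemma path_count_Suc: "path_count (Suc m) d = path_count m (d - 1) + path_count m (d + 1)"
proof (cases "even (d + int m + 1)")
  case False
  then have "odd (d + int (Suc m))" "odd (d - 1 + int m)" "odd (d + 1 + int m)" by auto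
  then show ?thesis by (simp add: path_count_def binom_half_def)
next
  case True
  \<comment> \<open>\<open>e\<close> is the number of up-steps among \<open>m + 1\<close>. Pascal's
    rule does the rest, except at \<open>e \<le> 0\<close> and \<open>e = m + 1\<close>, where a
    binomial falls out of range.\<close>
  then obtain e where "d + int m + 1 = 2 * e" by (rule evenE)
  then have d: "d = 2 * e - int m - 1" by simp
  have E: "d + int (Suc m) = 2 * e" "d - 1 + int m = 2 * (e - 1)" "d + 1 + int m = 2 * e"
    by (simp_all add: d)
  have "(Suc m choose nat e) = (m choose nat (e - 1)) + (m choose nat e)" if "0 < e"
  proof -
    have "nat e = Suc (nat (e - 1))" using that by simp
    then show ?thesis by (metis binomial_Suc_Suc)
  qed
  then show ?thesis
    unfolding path_count_def binom_half_def E
    by (cases "e \<le> 0"; cases "e = int m + 1") (auto simp: binomial_eq_0 not_le)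
qed

lemma phi_rs_eq: "phi_rs r s u v = (if s \<le> r then 0 else path_count (s - r) (v - u))"
  by (simp add: phi_rs_def path_count_def)

text \<open>Since \<open>phi_rs\<close> vanishes at equal times, its recursion in \<open>s\<close>
  has a source term at \<open>s = r\<close>. In \<open>walk_wt_avoid\<close> this term accounts for
  walks stopped at a point of \<open>Q\<close> at time \<open>r\<close>.\<close>

lemma phi_rs_Suc:
  "phi_rs r (Suc s) u v = (if s = r then of_bool (v - 1 = u) + of_bool (v + 1 = u)
    else phi_rs r s u (v - 1) + phi_rs r s u (v + 1))"
proof (cases "s \<le> r")
  case False
  then have "Suc s - r = Suc (s - r)" by simp
  then show ?thesis using False by (simp add: phi_rs_eq path_count_Suc algebra_simps)
next
  case True
  then show ?thesis by (auto simp: phi_rs_eq path_count_Suc path_count_0)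
qed

definition avoid :: "(nat \<times> int) set \<Rightarrow> nat \<Rightarrow> int \<Rightarrow> real" where
  "avoid Q r u = of_bool ((r, u) \<notin> Q)"

text \<open>Decomposition of a path according to the first visited point of \<open>Q\<close>.\<close>

lemma walk_wt_avoid:
  assumes "finite Q"
  shows "walk_wt (avoid Q) r v u = path_count r (u - v) -
    (\<Sum>q\<in>Q. walk_wt (avoid Q) (fst q) v (snd q) * phi_rs (fst q) r (snd q) u)"
proof (induction r arbitrary: u)
  case 0
  then show ?case by (auto simp: path_count_0 phi_rs_def)
next
  case (Suc r)
  let ?W = "walk_wt (avoid Q)"
  \<comment> \<open>As the weight of the final position is not counted in \<open>?W\<close>, the
    subtracted sum consists of the walks that meet \<open>Q\<close> for the first time at time
    \<open>r\<close>.\<close>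
  have mark: "avoid Q r u' * ?W r v u' = ?W r v u' -
      (\<Sum>q\<in>Q. ?W (fst q) v (snd q) * of_bool (fst q = r \<and> u' = snd q))" for u'
  proof -
    have "(\<Sum>q\<in>Q. ?W (fst q) v (snd q) * of_bool (fst q = r \<and> u' = snd q)) =
        (\<Sum>q\<in>Q. if q = (r, u') then ?W r v u' else 0)"
      by (intro sum.cong refl) auto
    then show ?thesis using assms by (simp add: avoid_def)
  qed
  have phi: "phi_rs (fst q) (Suc r) (snd q) u =
      phi_rs (fst q) r (snd q) (u - 1) + of_bool (fst q = r \<and> u - 1 = snd q) +
      (phi_rs (fst q) r (snd q) (u + 1) + of_bool (fst q = r \<and> u + 1 = snd q))" for q :: "nat \<times> int"
    by (auto simp: phi_rs_Suc) (auto simp: phi_rs_eq)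
  have "?W (Suc r) v u = (?W r v (u - 1) + ?W r v (u + 1)) -
      (\<Sum>q\<in>Q. ?W (fst q) v (snd q) *
        (of_bool (fst q = r \<and> u - 1 = snd q) + of_bool (fst q = r \<and> u + 1 = snd q)))"
    by (simp add: mark distrib_left sum.distrib)
  also have "\<dots> = path_count (Suc r) (u - v) -
      (\<Sum>q\<in>Q. ?W (fst q) v (snd q) * phi_rs (fst q) (Suc r) (snd q) u)"
    unfolding Suc.IH phi by (simp add: path_count_Suc distrib_left sum.distrib algebra_simps)
  finally show ?case .
qed

text \<open>A solution of the linear walk recursion is the superposition of path counts from its
  initial data. It is applied to \<open>hexE\<close>; the time-reversed version below is applied to
  \<open>hexF\<close>.\<close>

lemma forward_transport:
  assumes "\<And>s u. s < T \<Longrightarrow> f (Suc s) u = f s (u - 1) + f s (u + 1)"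
    and "\<And>u. f 0 u = (\<Sum>j<a. M j * of_bool (u = 2 * int j))" and "s \<le> T"
  shows "f s u = (\<Sum>j<a. M j * path_count s (u - 2 * int j))"
  using assms(3)
proof (induction s arbitrary: u)
  case 0
  then show ?case by (simp add: assms(2) path_count_0)
next
  case (Suc s)
  then show ?case
    by (simp add: assms(1) path_count_Suc sum.distrib[symmetric] algebra_simps)
qed

lemma backward_transport:
  assumes "\<And>s u. s < T \<Longrightarrow> f s u = f (Suc s) (u + 1) + f (Suc s) (u - 1)"
    and "\<And>u. f T u = (\<Sum>j<a. M j * of_bool (u = e j))" and "s \<le> T"
  shows "f s u = (\<Sum>j<a. M j * path_count (T - s) (e j - u))"
  using assms(3)
proof (induction s arbitrary: u rule: inc_induct)
  case base
  show ?case unfolding assms(2) by (intro sum.cong refl) (auto simp: path_count_0)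
next
  case (step s)
  then have "T - s = Suc (T - Suc s)" by simp
  then show ?case using step
    by (simp add: assms(1) path_count_Suc sum.distrib[symmetric] algebra_simps)
qed

section \<open>Low-rank perturbations of determinants\<close>

text \<open>Sylvester's identity. The block matrix with rows (1, X) and (Y, 1) has the two
  triangular factorisations \<open>?L * ?U\<close> and \<open>?V * ?L\<close>, and \<open>?L\<close>
  has determinant 1.\<close>

lemma det_one_minus_mult_commute:
  fixes X Y :: "real mat"
  assumes X[simp]: "X \<in> carrier_mat n k" and Y[simp]: "Y \<in> carrier_mat k n"
  shows "det (1\<^sub>m n - X * Y) = det (1\<^sub>m k - Y * X)"
proof -
  let ?L = "four_block_mat (1\<^sub>m n) (0\<^sub>m n k) Y (1\<^sub>m k)"
  let ?U = "four_block_mat (1\<^sub>m n) X (0\<^sub>m k n) (1\<^sub>m k - Y * X)"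
  let ?V = "four_block_mat (1\<^sub>m n - X * Y) X (0\<^sub>m k n) (1\<^sub>m k)"
  have XY[simp]: "X * Y \<in> carrier_mat n n" and YX[simp]: "Y * X \<in> carrier_mat k k"
    using mult_carrier_mat[OF X Y] mult_carrier_mat[OF Y X] by auto
  have D[simp]: "1\<^sub>m n - X * Y \<in> carrier_mat n n" "1\<^sub>m k - Y * X \<in> carrier_mat k k"
    by (rule minus_carrier_mat, simp)+
  have cancel: "Z + (1\<^sub>m m - Z) = 1\<^sub>m m" "(1\<^sub>m m - Z) + Z = 1\<^sub>m m"
    if "Z \<in> carrier_mat m m" for Z :: "real mat" and m
    using that by (auto intro!: eq_matI)
  have "?L * ?U = four_block_mat (1\<^sub>m n) X Y (1\<^sub>m k)"
    by (subst mult_four_block_mat[of _ n n _ k _ k _ _ n _ k])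
      (simp_all add: cancel left_mult_zero_mat[OF D(2)] left_mult_one_mat[OF D(2)]
        left_mult_one_mat[OF X] right_mult_one_mat[OF Y] right_add_zero_mat[OF X] right_add_zero_mat[OF Y])
  also have "\<dots> = ?V * ?L"
    by (subst mult_four_block_mat[of _ n n _ k _ k _ _ n _ k])
      (simp_all add: cancel left_mult_zero_mat[OF Y] right_mult_zero_mat[OF D(1)] left_mult_one_mat[OF Y]
        right_mult_one_mat[OF X] right_mult_one_mat[OF D(1)] left_add_zero_mat[OF X] left_add_zero_mat[OF Y])
  finally have LU: "?L * ?U = ?V * ?L" .
  have c: "?L \<in> carrier_mat (n + k) (n + k)" "?U \<in> carrier_mat (n + k) (n + k)"
    "?V \<in> carrier_mat (n + k) (n + k)"
    by (simp_all add: four_block_carrier_mat)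
  have "det ?L * det ?U = det ?V * det ?L"
    unfolding det_mult[OF c(1,2), symmetric] det_mult[OF c(3,1), symmetric] LU ..
  moreover have "det ?L = 1"
    by (subst det_four_block_mat_upper_right_zero[of _ n _ k]) simp_all
  moreover have "det ?U = det (1\<^sub>m k - Y * X)"
    by (subst det_four_block_mat_lower_left_zero[of _ n _ k]) simp_all
  moreover have "det ?V = det (1\<^sub>m n - X * Y)"
    by (subst det_four_block_mat_lower_left_zero[of _ n _ k]) simp_all
  ultimately show ?thesis by simp
qed

text \<open>Sylvester's identity turns \<open>det (A - Gt * L)\<close> into a determinant of size
  \<open>k\<close>. Multiplying by \<open>1 + P\<close>, of determinant 1, replaces the first-visit
  matrix \<open>Gt\<close> by \<open>Gt * (1 + P)\<close>, which will be the matrix of plain path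
  counts.\<close>

lemma det_update:
  fixes A B At :: "real mat"
  assumes A[simp]: "A \<in> carrier_mat a a" and B[simp]: "B \<in> carrier_mat a a" and AB: "A * B = 1\<^sub>m a"
    and Gt[simp]: "Gt \<in> carrier_mat a k" and L[simp]: "L \<in> carrier_mat k a"
    and P[simp]: "P \<in> carrier_mat k k"
    and detP: "det (1\<^sub>m k + P) = 1" and At: "At = A - Gt * L"
  shows "det At = det A * det (1\<^sub>m k + P - L * B * (Gt * (1\<^sub>m k + P)))"
proof -
  have GtL[simp]: "Gt * L \<in> carrier_mat a a" using mult_carrier_mat[OF Gt L] .
  have BGt[simp]: "B * Gt \<in> carrier_mat a k" using mult_carrier_mat[OF B Gt] .
  have LBGt[simp]: "L * (B * Gt) \<in> carrier_mat k k" using mult_carrier_mat[OF L BGt] .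
  have Pc[simp]: "1\<^sub>m k + P \<in> carrier_mat k k" by simp
  have At_c: "At \<in> carrier_mat a a" unfolding At by (rule minus_carrier_mat) simp
  have BA: "B * A = 1\<^sub>m a" using mat_mult_left_right_inverse[OF A B AB] .
  have "B * At = 1\<^sub>m a - (B * Gt) * L"
    unfolding At mult_minus_distrib_mat[OF B A GtL] BA assoc_mult_mat[OF B Gt L] ..
  then have "det B * det At = det (1\<^sub>m k - L * (B * Gt))"
    using det_mult[OF B At_c] det_one_minus_mult_commute[OF BGt L] by simp
  also have "\<dots> = det ((1\<^sub>m k - L * (B * Gt)) * (1\<^sub>m k + P))"
    by (subst det_mult[of _ k]) (simp_all add: detP minus_carrier_mat)
  also have "(1\<^sub>m k - L * (B * Gt)) * (1\<^sub>m k + P) = 1\<^sub>m k + P - L * (B * Gt) * (1\<^sub>m k + P)"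
    by (subst minus_mult_distrib_mat[of _ k k _ _ k]) (simp_all add: left_mult_one_mat[OF Pc])
  also have "L * (B * Gt) * (1\<^sub>m k + P) = L * B * (Gt * (1\<^sub>m k + P))"
    unfolding assoc_mult_mat[OF L B Gt, symmetric]
    by (rule assoc_mult_mat[OF mult_carrier_mat[OF L B] Gt Pc])
  finally have *: "det B * det At = det (1\<^sub>m k + P - L * B * (Gt * (1\<^sub>m k + P)))" .
  have "det A * det B = 1" using det_mult[OF A B] AB by simp
  then have "det At = det A * (det B * det At)" by (simp flip: mult.assoc)
  then show ?thesis unfolding * .
qed

text \<open>In a nonzero Leibniz term every moved index strictly increases \<open>t\<close>. Since a
  permutation preserves the sum of \<open>t\<close>, no index moves. Points sharing a time thus need
  no ordering.\<close>

lemma det_one_plus_strict: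
  fixes P :: "nat \<Rightarrow> nat \<Rightarrow> real" and t :: "nat \<Rightarrow> nat"
  assumes "\<And>i j. i < k \<Longrightarrow> j < k \<Longrightarrow> t j \<le> t i \<Longrightarrow> P i j = 0"
  shows "det (mat k k (\<lambda>(i, j). of_bool (i = j) + P i j)) = 1"
proof -
  have "(\<Prod>i<k. of_bool (i = p i) + P i (p i)) = 0" if p: "p permutes {..<k}" and "p \<noteq> id" for p
  proof -
    have "\<exists>i<k. p i \<noteq> i \<and> t (p i) \<le> t i"
    proof (rule ccontr)
      assume "\<not> ?thesis"
      then have less: "p i = i \<or> t i < t (p i)" if "i < k" for i using that by (auto simp: not_le)
      then have le: "t i \<le> t (p i)" if "i < k" for i using less[OF that] by auto
      from \<open>p \<noteq> id\<close> obtain i where "p i \<noteq> i" by (auto simp: fun_eq_iff)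
      then have "i < k" using p by (auto simp: permutes_def)
      then have "(\<Sum>i<k. t i) < (\<Sum>i<k. t (p i))"
        using le less[of i] \<open>p i \<noteq> i\<close> by (intro sum_strict_mono_ex1) auto
      moreover have "(\<Sum>i<k. t (p i)) = (\<Sum>i<k. t i)"
        using sum.permute[OF p, of t] by (simp add: o_def)
      ultimately show False by simp
    qed
    then obtain i where "i < k" "p i \<noteq> i" "t (p i) \<le> t i" by blast
    moreover have "p i < k" using p \<open>i < k\<close> permutes_in_image by fastforce
    ultimately have "of_bool (i = p i) + P i (p i) = 0" using assms by auto
    then show ?thesis using \<open>i < k\<close> by (intro prod_zero bexI[of _ i]) auto
  qed
  then have "det (mat k k (\<lambda>(i, j). of_bool (i = j) + P i j)) =
      (\<Sum>p\<in>{id}. signof p * (\<Prod>i<k. of_bool (i = p i) + P i (p i)))"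
    unfolding det_mat_leibniz
    by (intro sum.mono_neutral_right) (auto simp: permutes_id finite_permutations)
  then show ?thesis using assms by simp
qed

section \<open>Contiguity relations of the Hahn polynomials\<close>

definition ffall :: "real \<Rightarrow> nat \<Rightarrow> real" where
  "ffall x j = (\<Prod>i<j. x - real i)"

lemma ffall_0 [simp]: "ffall x 0 = 1"
  by (simp add: ffall_def)

lemma ffall_Suc: "ffall x (Suc j) = ffall x j * (x - real j)"
  by (simp add: ffall_def)

lemma ffall_Suc_left: "ffall x (Suc j) = x * ffall (x - 1) j"
  unfolding ffall_def by (subst prod.lessThan_Suc_shift) (simp add: algebra_simps)

lemma ffall_add1: "ffall (x + 1) (Suc j) = ffall x (Suc j) + real (Suc j) * ffall x j"
  by (subst ffall_Suc_left) (simp add: ffall_Suc algebra_simps)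

lemma ffall_pochhammer: "ffall x j = (-1) ^ j * pochhammer (- x) j"
  by (induction j) (simp_all add: ffall_Suc pochhammer_Suc algebra_simps)

lemma ffall_of_nat: "ffall (real m) j = (if j \<le> m then fact m / fact (m - j) else 0)"
proof (induction j)
  case (Suc j)
  show ?case
  proof (cases "Suc j \<le> m")
    case True
    then have "m - j = Suc (m - Suc j)" by simp
    then show ?thesis using Suc True by (simp add: ffall_Suc of_nat_diff field_simps)
  qed (use Suc in \<open>auto simp: ffall_Suc not_le less_Suc_eq\<close>)
qed simp

text \<open>Coefficient of \<open>ffall x j\<close> in the Hahn polynomial without the normalisation
  \<open>hahn_d\<close>. The prefactor is moved inside the sum, where (-A)_n / (-A)_j = (j -
  A)_(n-j), and likewise for \<open>B\<close>; no denominator contains a parameter any more.\<close>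

definition hahn_coeff :: "nat \<Rightarrow> real \<Rightarrow> real \<Rightarrow> real \<Rightarrow> nat \<Rightarrow> real" where
  "hahn_coeff n A B S j = pochhammer (real n - S) j *
    pochhammer (real j - A) (n - j) * pochhammer (real j - B) (n - j) / (fact j * fact (n - j))"

definition hahn_poly :: "nat \<Rightarrow> real \<Rightarrow> real \<Rightarrow> real \<Rightarrow> real \<Rightarrow> real" where
  "hahn_poly n A B S x = (\<Sum>j\<le>n. hahn_coeff n A B S j * ffall x j)"

lemma hahn_poly_swap: "hahn_poly n A B S = hahn_poly n B A S"
  by (simp add: hahn_poly_def hahn_coeff_def mult_ac fun_eq_iff)

text \<open>The three phases of the hexagon (before \<open>b\<close>, between \<open>b\<close> and \<open>c\<close>, after \<open>c\<close>) only use the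
  next two contiguity relations, by the symmetry in the parameters \<open>A = N + \<beta>\<close> and \<open>B = N\<close>; the
  third parameter \<open>S = 2 N + \<alpha> + \<beta> + 1\<close> does not change along the walk.\<close>

lemma hahn_poly_raise:
  "(B + 1 - y) * hahn_poly n A B S y + y * hahn_poly n A B S (y - 1) =
    (B + 1 - real n) * hahn_poly n A (B + 1) S y"
proof -
  have termwise: "(B + 1 - y) * (hahn_coeff n A B S j * ffall y j) + y * (hahn_coeff n A B S j * ffall (y - 1) j)
      = (B + 1 - real n) * (hahn_coeff n A (B + 1) S j * ffall y j)" if "j \<le> n" for j
  proof -
    have "y * ffall (y - 1) j = ffall y j * (y - real j)"
      by (simp flip: ffall_Suc ffall_Suc_left)
    then have "(B + 1 - y) * (hahn_coeff n A B S j * ffall y j) + y * (hahn_coeff n A B S j * ffall (y - 1) j)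
        = hahn_coeff n A B S j * ((B + 1 - y) * ffall y j + ffall y j * (y - real j))"
      by (metis distrib_left mult.left_commute)
    also have "\<dots> = (B + 1 - real j) * hahn_coeff n A B S j * ffall y j"
      by (simp add: algebra_simps)
    finally have eq: "(B + 1 - y) * (hahn_coeff n A B S j * ffall y j) + y * (hahn_coeff n A B S j * ffall (y - 1) j)
        = (B + 1 - real j) * hahn_coeff n A B S j * ffall y j" .
    \<comment> \<open>Both sides equal -(j - B - 1)_(n-j+1), split at its first and at its last
      factor.\<close>
    have "(B + 1 - real j) * pochhammer (real j - B) (n - j) =
        (B + 1 - real n) * pochhammer (real j - (B + 1)) (n - j)"
      using pochhammer_rec[of "real j - (B + 1)" "n - j"] pochhammer_rec'[of "real j - (B + 1)" "n - j"] that
      by (simp add: of_nat_diff algebra_simps)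
    from arg_cong[OF this, of "\<lambda>t. pochhammer (real n - S) j * pochhammer (real j - A) (n - j) * t / (fact j * fact (n - j))"]
    have "(B + 1 - real j) * hahn_coeff n A B S j = (B + 1 - real n) * hahn_coeff n A (B + 1) S j"
      unfolding hahn_coeff_def by (simp only: mult_ac times_divide_eq_right)
    with eq show ?thesis by (simp only: mult.assoc)
  qed
  show ?thesis
    unfolding hahn_poly_def sum_distrib_left sum.distrib[symmetric]
    by (rule sum.cong[OF refl]) (use termwise in auto)
qed

text \<open>Comparison of coefficients of \<open>ffall y j\<close> for
  \<open>hahn_poly_lower\<close>. All three coefficients are explicit multiples of one quantity
  \<open>W\<close>, which reduces the claim to the quadratic identity \<open>key\<close>.\<close>

lemma hahn_coeff_lower:
  assumes "j \<le> n"
  shows "(S - A - real n) * hahn_coeff n (A - 1) B S j = (S - A - real j) * hahn_coeff n A B S j +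
    (if j < n then real (Suc j) * (B - real j) * hahn_coeff n A B S (Suc j) else 0)"
proof (cases "j < n")
  case False
  with assms have "j = n" by simp
  then show ?thesis by (simp add: hahn_coeff_def)
next
  case True
  define m where "m = n - Suc j"
  have nj: "n - j = Suc m" "n - Suc j = m" and n: "real n = real j + 1 + real m"
    using True by (simp_all add: m_def of_nat_diff)
  define K where "K = pochhammer (real n - S) j"
  define u where "u = pochhammer (real j + 1 - A) m"
  define v where "v = pochhammer (real j + 1 - B) m"
  have shift: "real j - x + 1 = real j + 1 - x" "real j - (x - 1) = real j + 1 - x" for x :: real
    by simp_all
  have p: "pochhammer (real j - A) (Suc m) = (real j - A) * u"
    "pochhammer (real j - B) (Suc m) = (real j - B) * v"
    unfolding u_def v_def pochhammer_rec shift by simp_all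
  have p': "pochhammer (real j - (A - 1)) (Suc m) = u * (real n - A)"
    unfolding u_def shift n pochhammer_Suc by (simp add: algebra_simps)
  have s1: "real (Suc j) - x = real j + 1 - x" for x by simp
  have c1: "hahn_coeff n A B S (Suc j) * real (Suc j) = K * (real n - S + real j) * u * v / (fact j * fact m)"
    unfolding hahn_coeff_def nj pochhammer_Suc fact_Suc s1 K_def u_def v_def
    by (simp del: of_nat_Suc)
  have c0: "hahn_coeff n A B S j = K * (real j - A) * u * ((real j - B) * v) / (fact j * (real (Suc m) * fact m))"
    unfolding hahn_coeff_def nj p by (simp add: K_def)
  have c2: "hahn_coeff n (A - 1) B S j = K * (u * (real n - A)) * ((real j - B) * v) / (fact j * (real (Suc m) * fact m))"
    unfolding hahn_coeff_def nj p p' by (simp add: K_def)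
  have key: "(S - A - real n) * (real n - A) =
      (S - A - real j) * (real j - A) - real (Suc m) * (real n - S + real j)"
    unfolding n by (simp add: algebra_simps)
  define W where "W = K * u * ((real j - B) * v) / (fact j * (real (Suc m) * fact m))"
  have "real (Suc j) * (B - real j) * hahn_coeff n A B S (Suc j) =
      (B - real j) * (hahn_coeff n A B S (Suc j) * real (Suc j))" by simp
  also have "\<dots> = - (real (Suc m) * (real n - S + real j)) * W"
    unfolding c1 W_def by (simp add: field_simps del: of_nat_Suc)
  finally have e1: "real (Suc j) * (B - real j) * hahn_coeff n A B S (Suc j) =
    - (real (Suc m) * (real n - S + real j)) * W" .
  have e0: "hahn_coeff n A B S j = (real j - A) * W" unfolding c0 W_def by simp
  have e2: "hahn_coeff n (A - 1) B S j = (real n - A) * W" unfolding c2 W_def by simp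
  have "(S - A - real n) * hahn_coeff n (A - 1) B S j = ((S - A - real n) * (real n - A)) * W"
    unfolding e2 by simp
  also have "\<dots> = (S - A - real j) * hahn_coeff n A B S j - (real (Suc m) * (real n - S + real j)) * W"
    unfolding key e0 by (simp add: algebra_simps)
  finally show ?thesis using True e1 by simp
qed

lemma hahn_poly_lower:
  "(S - A - B + y) * hahn_poly n A B S y + (B - y) * hahn_poly n A B S (y + 1) =
    (S - A - real n) * hahn_poly n (A - 1) B S y"
proof -
  let ?c = "hahn_coeff n A B S"
  \<comment> \<open>The shift to \<open>y + 1\<close> produces a term of degree \<open>j - 1\<close>
    via \<open>ffall_add1\<close>; \<open>?t j\<close> is this term, and reindexing moves it to
    degree \<open>j\<close>.\<close>
  let ?t = "\<lambda>j. if j = 0 then 0 else real j * (B + 1 - real j) * ?c j * ffall y (j - 1)"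
  have termwise: "(S - A - B + y) * (?c j * ffall y j) + (B - y) * (?c j * ffall (y + 1) j) =
      (S - A - real j) * ?c j * ffall y j + ?t j" for j
  proof (cases j)
    case (Suc i)
    show ?thesis unfolding Suc ffall_add1 unfolding ffall_Suc by (simp add: algebra_simps)
  qed (simp add: algebra_simps)
  have "(S - A - B + y) * hahn_poly n A B S y + (B - y) * hahn_poly n A B S (y + 1) =
      (\<Sum>j\<le>n. (S - A - real j) * ?c j * ffall y j) + (\<Sum>j\<le>n. ?t j)"
    unfolding hahn_poly_def sum_distrib_left sum.distrib[symmetric] termwise ..
  also have "(\<Sum>j\<le>n. ?t j) = (\<Sum>j<n. ?t (Suc j))"
    by (subst lessThan_Suc_atMost[symmetric], subst sum.lessThan_Suc_shift) simp
  also have "\<dots> = (\<Sum>j<n. real (Suc j) * (B - real j) * ?c (Suc j) * ffall y j)"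
    by simp
  also have "\<dots> = (\<Sum>j\<le>n. (if j < n then real (Suc j) * (B - real j) * ?c (Suc j) else 0) * ffall y j)"
    by (rule sum.mono_neutral_cong_left) auto
  also have "(\<Sum>j\<le>n. (S - A - real j) * ?c j * ffall y j) + \<dots> =
      (\<Sum>j\<le>n. (S - A - real n) * (hahn_coeff n (A - 1) B S j * ffall y j))"
    unfolding sum.distrib[symmetric]
  proof (rule sum.cong[OF refl])
    fix j assume "j \<in> {..n}"
    then have "j \<le> n" by simp
    from hahn_coeff_lower[OF this, of S A B]
    show "(S - A - real j) * ?c j * ffall y j +
        (if j < n then real (Suc j) * (B - real j) * ?c (Suc j) else 0) * ffall y j =
      (S - A - real n) * (hahn_coeff n (A - 1) B S j * ffall y j)"
      by (simp only: mult.assoc[symmetric] distrib_right[symmetric])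
  qed
  finally show ?thesis by (simp only: hahn_poly_def sum_distrib_left)
qed

text \<open>The contiguity relations with all constants as free variables, so that they unify with
  the evaluated parameters of each phase and leave only arithmetic. The suffixes tell whether the
  first parameter \<open>A\<close> or the second parameter \<open>B\<close> moves.\<close>

lemma hahn_poly_raise_right:
  assumes "B' = B + 1" "k = B + 1" "l = B + 1 - real n"
  shows "(k - y) * hahn_poly n A B S y + y * hahn_poly n A B S (y - 1) = l * hahn_poly n A B' S y"
  unfolding assms by (rule hahn_poly_raise)

lemma hahn_poly_raise_left:
  assumes "A' = A + 1" "k = A + 1" "l = A + 1 - real n"
  shows "(k - y) * hahn_poly n A B S y + y * hahn_poly n A B S (y - 1) = l * hahn_poly n A' B S y"
  using hahn_poly_raise_right[OF assms, of y B S] by (simp only: hahn_poly_swap[of n B])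

lemma hahn_poly_lower_left:
  assumes "A' = A - 1" "k = S - A - B" "l = S - A - real n"
  shows "(k + y) * hahn_poly n A B S y + (B - y) * hahn_poly n A B S (y + 1) = l * hahn_poly n A' B S y"
  unfolding assms by (rule hahn_poly_lower)

lemma hahn_poly_lower_right:
  assumes "B' = B - 1" "k = S - A - B" "l = S - B - real n"
  shows "(k + y) * hahn_poly n A B S y + (A - y) * hahn_poly n A B S (y + 1) = l * hahn_poly n A B' S y"
proof -
  have "k = S - B - A" using assms(2) by simp
  from hahn_poly_lower_left[OF assms(1) this assms(3), of y] show ?thesis
    by (simp only: hahn_poly_swap[of n _ A])
qed

section \<open>Alternating binomial sums\<close>

text \<open>The sum is, up to sign, an \<open>n\<close>-th finite difference at 0, and each
  difference lowers the degree by cancelling leading coefficients. Constants are treated apart,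
  since their difference 0 still has degree 0.\<close>

lemma alternating_binomial_sum_poly:
  fixes p :: "real poly"
  assumes "degree p < n"
  shows "(\<Sum>j\<le>n. (-1) ^ j * real (n choose j) * poly p (real j)) = 0"
  using assms
proof (induction n arbitrary: p)
  case (Suc n)
  define q where "q = p - p \<circ>\<^sub>p [:1, 1:]"
  have shift: "(\<Sum>j\<le>Suc n. (-1) ^ j * real (Suc n choose j) * f j) =
      (\<Sum>j\<le>n. (-1) ^ j * real (n choose j) * (f j - f (Suc j)))" for f :: "nat \<Rightarrow> real"
  proof -
    have "(\<Sum>j\<le>Suc n. (-1) ^ j * real (Suc n choose j) * f j) =
        f 0 + (\<Sum>j\<le>n. (-1) ^ Suc j * (real (n choose j) + real (n choose Suc j)) * f (Suc j))"
      by (subst sum.atMost_Suc_shift) simp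
    also have "\<dots> = (f 0 + (\<Sum>j\<le>n. (-1) ^ Suc j * real (n choose Suc j) * f (Suc j)))
        + (\<Sum>j\<le>n. (-1) ^ Suc j * real (n choose j) * f (Suc j))"
      by (simp add: sum.distrib[symmetric] algebra_simps)
    also have "f 0 + (\<Sum>j\<le>n. (-1) ^ Suc j * real (n choose Suc j) * f (Suc j)) =
        (\<Sum>j\<le>Suc n. (-1) ^ j * real (n choose j) * f j)"
      by (simp only: sum.atMost_Suc_shift) simp
    also have "\<dots> = (\<Sum>j\<le>n. (-1) ^ j * real (n choose j) * f j)" by simp
    finally show ?thesis by (simp add: sum.distrib[symmetric] algebra_simps)
  qed
  have "(\<Sum>j\<le>Suc n. (-1) ^ j * real (Suc n choose j) * poly p (real j)) =
      (\<Sum>j\<le>n. (-1) ^ j * real (n choose j) * poly q (real j))"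
    by (subst shift) (simp add: q_def poly_pcompose add.commute)
  also have "\<dots> = 0"
  proof (cases "degree p = 0")
    case True
    then obtain x where "p = [:x:]" by (rule degree_eq_zeroE)
    then show ?thesis by (simp add: q_def pcompose_const)
  next
    case False
    have "degree q < degree p"
    proof (rule degree_lessI)
      show "q \<noteq> 0 \<or> 0 < degree p" using False by simp
      show "\<forall>k\<ge>degree p. coeff q k = 0"
      proof (intro allI impI)
        fix k assume k: "degree p \<le> k"
        have dp: "degree (p \<circ>\<^sub>p [:1, 1:]) = degree p" by (simp add: degree_pcompose)
        show "coeff q k = 0"
        proof (cases "k = degree p")
          case True
          have "lead_coeff (p \<circ>\<^sub>p [:1, 1:]) = lead_coeff p"
            by (subst lead_coeff_comp) simp_all
          then show ?thesis using dp True by (simp add: q_def)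
        next
          case False
          then show ?thesis using k dp by (simp add: q_def coeff_eq_0)
        qed
      qed
    qed
    then show ?thesis using Suc.prems by (intro Suc.IH) simp
  qed
  finally show ?case .
qed simp

text \<open>Partial fraction expansion of n! / (z (z-1) ... (z-n)). Pascal's rule gives s_(n+1)(z) =
  s_n(z) - s_n(z - 1) for the left-hand side s_n.\<close>

lemma alternating_binomial_sum_inverse:
  assumes "\<And>j. j \<le> n \<Longrightarrow> z \<noteq> real j"
  shows "(\<Sum>j\<le>n. (-1) ^ j * real (n choose j) / (z - real j)) = (-1) ^ n * fact n / ffall z (Suc n)"
  using assms
proof (induction n arbitrary: z)
  case 0
  then show ?case by (simp add: ffall_Suc)
next
  case (Suc n)
  let ?s = "\<lambda>z. \<Sum>j\<le>n. (-1) ^ j * real (n choose j) / (z - real j)"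
  have "(\<Sum>j\<le>Suc n. (-1) ^ j * real (Suc n choose j) / (z - real j)) =
      1 / z + (\<Sum>j\<le>n. (-1) ^ Suc j * (real (n choose j) + real (n choose Suc j)) / (z - real (Suc j)))"
    by (subst sum.atMost_Suc_shift) simp
  also have "\<dots> = (1 / z + (\<Sum>j\<le>n. (-1) ^ Suc j * real (n choose Suc j) / (z - real (Suc j))))
      + (\<Sum>j\<le>n. (-1) ^ Suc j * real (n choose j) / (z - real (Suc j)))"
    unfolding add.assoc sum.distrib[symmetric]
    by (rule arg_cong[where f = "(+) (1 / z)"], rule sum.cong[OF refl])
      (simp add: ring_distribs add_divide_distrib diff_divide_distrib)
  also have "1 / z + (\<Sum>j\<le>n. (-1) ^ Suc j * real (n choose Suc j) / (z - real (Suc j))) =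
      (\<Sum>j\<le>Suc n. (-1) ^ j * real (n choose j) / (z - real j))"
    by (simp only: sum.atMost_Suc_shift) simp
  also have "\<dots> = ?s z" by simp
  also have "(\<Sum>j\<le>n. (-1) ^ Suc j * real (n choose j) / (z - real (Suc j))) = - ?s (z - 1)"
    unfolding sum_negf[symmetric] by (simp add: algebra_simps)
  finally have "(\<Sum>j\<le>Suc n. (-1) ^ j * real (Suc n choose j) / (z - real j)) = ?s z - ?s (z - 1)"
    by simp
  also have "\<dots> = (-1) ^ n * fact n / ffall z (Suc n) - (-1) ^ n * fact n / ffall (z - 1) (Suc n)"
  proof -
    have "z - 1 \<noteq> real j" if "j \<le> n" for j using Suc.prems[of "Suc j"] that by auto
    then show ?thesis using Suc.IH[of z] Suc.IH[of "z - 1"] Suc.prems by simp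
  qed
  also have "\<dots> = (-1) ^ Suc n * fact (Suc n) / ffall z (Suc (Suc n))"
  proof -
    define P where "P = ffall (z - 1) n"
    have nz: "z \<noteq> 0" "z - real (Suc n) \<noteq> 0" using Suc.prems[of 0] Suc.prems[of "Suc n"] by auto
    have "P \<noteq> 0" unfolding P_def ffall_def
      using Suc.prems[of "Suc _"] by (auto simp: prod_zero_iff algebra_simps)
    have e: "ffall z (Suc n) = z * P" "ffall (z - 1) (Suc n) = P * (z - real (Suc n))"
      "ffall z (Suc (Suc n)) = z * P * (z - real (Suc n))"
      by (simp_all add: P_def ffall_Suc_left[of z] ffall_Suc[of "z - 1"] algebra_simps)
    show ?thesis unfolding e using nz \<open>P \<noteq> 0\<close> by (simp add: divide_simps) (simp add: algebra_simps)
  qed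
  finally show ?case .
qed

section \<open>Orthogonality of the Hahn polynomials\<close>

lemma ffall_poly:
  "\<exists>p. degree p \<le> i \<and> (\<forall>x. poly p x = ffall (z - x) i)" for z :: real
proof (induction i)
  case 0
  show ?case by (rule exI[of _ 1]) simp
next
  case (Suc i)
  then obtain p where p: "degree p \<le> i" "\<And>x. poly p x = ffall (z - x) i" by blast
  have "degree (p * [:z - real i, -1:]) \<le> degree p + degree [:z - real i, -1::real:]"
    by (rule degree_mult_le)
  also have "\<dots> \<le> Suc i" using p(1) by simp
  finally have "degree (p * [:z - real i, -1:]) \<le> Suc i" .
  moreover have "poly (p * [:z - real i, -1:]) x = ffall (z - x) (Suc i)" for x
    by (simp add: p(2) ffall_Suc algebra_simps)
  ultimately show ?case by blast
qed

text \<open>As a polynomial in t of degree at most n, \<open>ffall (x - t) n\<close> is divided by t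
  - z. The quotient is annihilated by the alternating sum, and the remainder
  \<open>ffall (x - z) n\<close> multiplies the partial fraction sum.\<close>

lemma alternating_ffall_quotient:
  assumes "\<And>j. j \<le> n \<Longrightarrow> z \<noteq> real j"
  shows "(\<Sum>j\<le>n. (-1) ^ j * real (n choose j) * ffall (x - real j) n / (z - real j)) =
    ffall (x - z) n * ((-1) ^ n * fact n / ffall z (Suc n))"
proof -
  obtain p where p: "degree p \<le> n" "\<And>t. poly p t = ffall (x - t) n" using ffall_poly by blast
  define q where "q = synthetic_div p z"
  have pq: "poly p t = (t - z) * poly q t + poly p z" for t
    using arg_cong[OF synthetic_div_correct'[of z p], of "\<lambda>p. poly p t"]
    by (simp add: q_def algebra_simps)
  have "(\<Sum>j\<le>n. (-1) ^ j * real (n choose j) * poly q (real j)) = 0"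
  proof (cases "n = 0")
    case True
    then have "q = 0" using p(1) by (simp add: q_def synthetic_div_eq_0_iff)
    then show ?thesis by simp
  next
    case False
    then show ?thesis
      using p(1) by (intro alternating_binomial_sum_poly) (simp add: q_def degree_synthetic_div)
  qed
  moreover have "(-1) ^ j * real (n choose j) * ffall (x - real j) n / (z - real j) =
      poly p z * ((-1) ^ j * real (n choose j) / (z - real j)) - (-1) ^ j * real (n choose j) * poly q (real j)"
    if "j \<le> n" for j
  proof -
    have "z - real j \<noteq> 0" using assms[OF that] by simp
    then have "ffall (x - real j) n / (z - real j) = poly p z / (z - real j) - poly q (real j)"
      unfolding p(2)[symmetric] pq[of "real j"] by (simp add: field_simps)
    from arg_cong[OF this, of "\<lambda>t. (-1) ^ j * real (n choose j) * t"]
    show ?thesis by (simp add: right_diff_distrib mult_ac)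
  qed
  then have "(\<Sum>j\<le>n. (-1) ^ j * real (n choose j) * ffall (x - real j) n / (z - real j)) =
      (\<Sum>j\<le>n. poly p z * ((-1) ^ j * real (n choose j) / (z - real j)) - (-1) ^ j * real (n choose j) * poly q (real j))"
    by (intro sum.cong) auto
  ultimately have "(\<Sum>j\<le>n. (-1) ^ j * real (n choose j) * ffall (x - real j) n / (z - real j)) =
      poly p z * (\<Sum>j\<le>n. (-1) ^ j * real (n choose j) / (z - real j))"
    by (simp only: sum_subtractf sum_distrib_left diff_zero)
  also have "(\<Sum>j\<le>n. (-1) ^ j * real (n choose j) / (z - real j)) = (-1) ^ n * fact n / ffall z (Suc n)"
    using assms by (rule alternating_binomial_sum_inverse)
  finally show ?thesis unfolding p(2) .
qed

text \<open>Triangular change of basis from falling factorials in x to those in A - x; orthogonality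
  needs only its diagonal entries.\<close>

lemma ffall_reflect:
  "\<exists>k. (\<forall>x. ffall x j = (\<Sum>i\<le>j. k i * ffall (A - x) i)) \<and> k j = (-1) ^ j" for A :: real
proof (induction j)
  case 0
  show ?case by (rule exI[of _ "\<lambda>_. 1"]) simp
next
  case (Suc j)
  then obtain k where k: "\<And>x. ffall x j = (\<Sum>i\<le>j. k i * ffall (A - x) i)" "k j = (-1) ^ j" by blast
  \<comment> \<open>The new factor is split as x - j = (A - j - i) - (A - x - i), whose second part
    raises \<open>ffall (A - x) i\<close> to index \<open>i + 1\<close>.\<close>
  define l where "l i = (if i \<le> j then k i * (A - real j - real i) else 0) -
    (if i = 0 then 0 else k (i - 1))" for i
  have "ffall x (Suc j) = (\<Sum>i\<le>Suc j. l i * ffall (A - x) i)" for x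
  proof -
    have "ffall x (Suc j) = (\<Sum>i\<le>j. k i * (A - real j - real i) * ffall (A - x) i - k i * ffall (A - x) (Suc i))"
      unfolding ffall_Suc[of x] k(1) sum_distrib_right
      by (rule sum.cong[OF refl]) (simp add: ffall_Suc algebra_simps)
    also have "\<dots> = (\<Sum>i\<le>Suc j. (if i \<le> j then k i * (A - real j - real i) else 0) * ffall (A - x) i)
        - (\<Sum>i\<le>Suc j. (if i = 0 then 0 else k (i - 1)) * ffall (A - x) i)"
    proof -
      have "(\<Sum>i\<le>j. k i * ffall (A - x) (Suc i)) =
          (\<Sum>i\<le>Suc j. (if i = 0 then 0 else k (i - 1)) * ffall (A - x) i)"
        by (simp only: sum.atMost_Suc_shift) simp
      moreover have "(\<Sum>i\<le>j. k i * (A - real j - real i) * ffall (A - x) i) =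
          (\<Sum>i\<le>Suc j. (if i \<le> j then k i * (A - real j - real i) else 0) * ffall (A - x) i)"
        by simp
      ultimately show ?thesis by (simp only: sum_subtractf)
    qed
    also have "\<dots> = (\<Sum>i\<le>Suc j. l i * ffall (A - x) i)"
      by (simp only: l_def left_diff_distrib sum_subtractf)
    finally show ?thesis .
  qed
  moreover have "l (Suc j) = (-1) ^ Suc j" by (simp add: l_def k(2))
  ultimately show ?case by blast
qed

lemma hahn_coeff_nat:
  assumes "j \<le> n" "n \<le> A" "n \<le> B" "2 * n \<le> S"
  shows "hahn_coeff n (real A) (real B) (real S) j = (-1) ^ j * (fact (S - n) / fact (S - n - j)) *
    (fact (A - j) / fact (A - n)) * (fact (B - j) / fact (B - n)) / (fact j * fact (n - j))"
proof -
  have p: "pochhammer (real j - real X) (n - j) = (-1) ^ (n - j) * (fact (X - j) / fact (X - n))"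
    if "n \<le> X" for X
  proof -
    have "(-1) ^ (n - j) * pochhammer (- real (X - j)) (n - j) = ffall (real (X - j)) (n - j)"
      by (simp add: ffall_pochhammer)
    also have "\<dots> = fact (X - j) / fact (X - n)"
      using assms(1) that by (subst ffall_of_nat) simp
    finally have "(-1) ^ (n - j) * pochhammer (- real (X - j)) (n - j) = fact (X - j) / fact (X - n)" .
    from arg_cong[OF this, of "\<lambda>t. (-1) ^ (n - j) * t"] show ?thesis
      using assms(1) that by (simp add: of_nat_diff flip: mult.assoc power_mult_distrib)
  qed
  have "(-1) ^ j * pochhammer (- real (S - n)) j = fact (S - n) / fact (S - n - j)"
    using assms(1,4) by (subst ffall_pochhammer[symmetric], subst ffall_of_nat) simp
  from arg_cong[OF this, of "\<lambda>t. (-1) ^ j * t"]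
  have q: "pochhammer (real n - real S) j = (-1) ^ j * (fact (S - n) / fact (S - n - j))"
    using assms by (simp add: of_nat_diff flip: mult.assoc power_mult_distrib)
  have s: "((-1) ^ (n - j) * u) * ((-1) ^ (n - j) * v) = u * v" for u v :: real
    by (simp add: mult_ac flip: power_mult_distrib)
  have "hahn_coeff n (real A) (real B) (real S) j = (-1) ^ j * (fact (S - n) / fact (S - n - j)) *
    (((-1) ^ (n - j) * (fact (A - j) / fact (A - n))) * ((-1) ^ (n - j) * (fact (B - j) / fact (B - n)))) / (fact j * fact (n - j))"
    unfolding hahn_coeff_def p[OF assms(2)] p[OF assms(3)] q by (simp only: mult.assoc)
  then show ?thesis unfolding s by (simp only: mult.assoc)
qed

text \<open>The weight w(x) with N = \<open>B\<close>, N + \<beta> = \<open>A\<close> and \<alpha> =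
  \<open>al\<close>.\<close>

definition hahn_weight :: "nat \<Rightarrow> nat \<Rightarrow> nat \<Rightarrow> nat \<Rightarrow> real" where
  "hahn_weight A B al x = 1 / (fact x * fact (B - x) * fact (al + x) * fact (A - x))"

text \<open>The two falling factorials cancel against x! and (A - x)! in the weight. A product of
  two binomials remains, which Vandermonde's identity sums; this is the reason for testing with
  powers of A - x.\<close>

lemma hahn_weight_moment:
  assumes "j \<le> B" "i \<le> A" "B \<le> A"
  shows "(\<Sum>x\<le>B. ffall (real x) j * ffall (real A - real x) i * hahn_weight A B al x) =
    ffall (real A - real j) i * fact (A + B + al - i - j) /
      (fact (B - j) * fact (A - j) * fact (A + al - i) * fact (B + al))"
proof -
  have t: "ffall (real x) j * ffall (real A - real x) i * hahn_weight A B al x =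
      real ((B - j) choose (B - x)) * real ((A + al - i) choose (x + al)) /
      (fact (B - j) * fact (A + al - i))" if "x \<le> B" for x
  proof (cases "j \<le> x \<and> x + i \<le> A")
    case True
    then have f: "ffall (real x) j = fact x / fact (x - j)"
      "ffall (real A - real x) i = fact (A - x) / fact (A - x - i)"
      using that assms ffall_of_nat[of "A - x" i] by (auto simp: ffall_of_nat of_nat_diff)
    have b: "real ((B - j) choose (B - x)) = fact (B - j) / (fact (B - x) * fact (x - j))"
      using True that by (subst binomial_fact) (auto simp: Suc_diff_le)
    have c: "real ((A + al - i) choose (x + al)) = fact (A + al - i) / (fact (x + al) * fact (A - x - i))"
      using True that by (subst binomial_fact) (auto simp: diff_diff_eq add.commute)
    show ?thesis unfolding f b c hahn_weight_def by (simp add: add.commute[of x al])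
  next
    case False
    then show ?thesis
    proof (cases "j \<le> x")
      case True
      then have "ffall (real A - real x) i = 0" "(A + al - i) choose (x + al) = 0"
        using False that assms ffall_of_nat[of "A - x" i] by (auto simp: of_nat_diff binomial_eq_0)
      then show ?thesis by simp
    next
      case False
      then have "(B - j) choose (B - x) = 0" using that assms(1) by (intro binomial_eq_0) linarith
      then show ?thesis using False by (simp add: ffall_of_nat)
    qed
  qed
  have "(\<Sum>x\<le>B. ((B - j) choose (B - x)) * ((A + al - i) choose (x + al))) =
      (\<Sum>k\<le>B. ((B - j) choose k) * ((A + al - i) choose (B - k + al)))"
    by (rule sum.reindex_bij_witness[of _ "\<lambda>k. B - k" "\<lambda>k. B - k"]) auto
  also have "\<dots> = (\<Sum>k\<le>B + al. ((B - j) choose k) * ((A + al - i) choose (B + al - k)))"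
    by (rule sum.mono_neutral_cong_left) (auto simp: binomial_eq_0)
  also have "\<dots> = (A + B + al - i - j) choose (B + al)"
    using assms by (subst vandermonde) (auto intro!: arg_cong2[where f = "(choose)"])
  finally have v: "(\<Sum>x\<le>B. ((B - j) choose (B - x)) * ((A + al - i) choose (x + al))) =
    (A + B + al - i - j) choose (B + al)" .
  \<comment> \<open>In this form the dependence on \<open>j\<close> includes the polynomial factor
    \<open>ffall (A - j) i\<close>, also where both sides vanish because i + j > A.\<close>
  have c: "real ((A + B + al - i - j) choose (B + al)) =
      ffall (real A - real j) i * fact (A + B + al - i - j) / (fact (A - j) * fact (B + al))"
  proof (cases "i + j \<le> A")
    case True
    then have "ffall (real A - real j) i = fact (A - j) / fact (A - i - j)"
    proof -
      have "i \<le> A - j" "j \<le> A" "A - j - i = A - i - j" using True by linarith+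
      then show ?thesis using ffall_of_nat[of "A - j" i] by (simp add: of_nat_diff)
    qed
    moreover have "A + B + al - i - j - (B + al) = A - i - j" using True by linarith
    ultimately show ?thesis using True by (subst binomial_fact) (auto simp: mult_ac)
  next
    case False
    then have "ffall (real A - real j) i = 0"
      using ffall_of_nat[of "A - j" i] assms by (simp add: of_nat_diff)
    moreover have "(A + B + al - i - j) choose (B + al) = 0"
      using False assms by (intro binomial_eq_0) linarith
    ultimately show ?thesis by simp
  qed
  have "(\<Sum>x\<le>B. ffall (real x) j * ffall (real A - real x) i * hahn_weight A B al x) =
      real (\<Sum>x\<le>B. ((B - j) choose (B - x)) * ((A + al - i) choose (x + al))) / (fact (B - j) * fact (A + al - i))"
    unfolding of_nat_sum sum_divide_distrib by (rule sum.cong[OF refl]) (simp add: t)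
  then show ?thesis unfolding v c by (simp add: mult_ac)
qed

text \<open>Inserting the moments leaves an alternating binomial sum over \<open>j\<close>, with a
  quotient of factorials. For i < n that quotient is a polynomial in \<open>j\<close> of degree n -
  1 - i, so the summand has degree below \<open>n\<close> and the sum vanishes. For i = n the
  quotient is 1/(S - n - j), and \<open>alternating_ffall_quotient\<close> evaluates the
  sum.\<close>

lemma hahn_poly_moment:
  assumes "i \<le> n" "n \<le> B" "B \<le> A" and S: "S = A + B + al + 1"
  shows "(\<Sum>x\<le>B. hahn_poly n A B S (real x) * ffall (real A - real x) i * hahn_weight A B al x) =
    (if i < n then 0
     else fact (S - 2 * n - 1) / (fact (A - n) * fact (B - n) * fact (A + al - n) * fact (B + al - n)))"
proof -
  define C where "C = fact (S - n) / (fact n * fact (A - n) * fact (B - n) * fact (A + al - i) * fact (B + al) :: real)"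
  have "(\<Sum>x\<le>B. hahn_poly n A B S (real x) * ffall (real A - real x) i * hahn_weight A B al x) =
      (\<Sum>j\<le>n. hahn_coeff n A B S j *
        (\<Sum>x\<le>B. ffall (real x) j * ffall (real A - real x) i * hahn_weight A B al x))"
    unfolding hahn_poly_def sum_distrib_left sum_distrib_right mult.assoc by (rule sum.swap)
  also have "\<dots> = (\<Sum>j\<le>n. C * ((-1) ^ j * real (n choose j) *
      (ffall (real A - real j) i * (fact (S - 1 - i - j) / fact (S - n - j)))))"
  proof (rule sum.cong[OF refl])
    fix j assume "j \<in> {..n}"
    then have j: "j \<le> n" by simp
    have "real (n choose j) = fact n / (fact j * fact (n - j))"
      using j by (rule binomial_fact)
    moreover have "A + B + al - i - j = S - 1 - i - j" using S by simp
    ultimately show "hahn_coeff n A B S j *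
        (\<Sum>x\<le>B. ffall (real x) j * ffall (real A - real x) i * hahn_weight A B al x) =
      C * ((-1) ^ j * real (n choose j) * (ffall (real A - real j) i * (fact (S - 1 - i - j) / fact (S - n - j))))"
      using assms j by (subst hahn_weight_moment, simp, simp, simp, subst hahn_coeff_nat)
        (simp_all add: C_def mult_ac)
  qed
  also have "\<dots> = C * (\<Sum>j\<le>n. (-1) ^ j * real (n choose j) *
      (ffall (real A - real j) i * (fact (S - 1 - i - j) / fact (S - n - j))))"
    by (simp only: sum_distrib_left)
  also have "\<dots> = (if i < n then 0
     else fact (S - 2 * n - 1) / (fact (A - n) * fact (B - n) * fact (A + al - n) * fact (B + al - n)))"
  proof (cases "i < n")
    case True
    obtain p where p: "degree p \<le> i" "\<And>x. poly p x = ffall (real A - x) i" using ffall_poly by blast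
    obtain q where q: "degree q \<le> n - 1 - i" "\<And>x. poly q x = ffall (real (S - 1 - i) - x) (n - 1 - i)"
      using ffall_poly by blast
    have "(\<Sum>j\<le>n. (-1) ^ j * real (n choose j) * (ffall (real A - real j) i * (fact (S - 1 - i - j) / fact (S - n - j))))
        = (\<Sum>j\<le>n. (-1) ^ j * real (n choose j) * poly (p * q) (real j))"
    proof (rule sum.cong[OF refl])
      fix j assume "j \<in> {..n}"
      then have j: "j \<le> n" by simp
      have "ffall (real (S - 1 - i) - real j) (n - 1 - i) = ffall (real (S - 1 - i - j)) (n - 1 - i)"
        using assms True j by (simp add: of_nat_diff diff_diff_eq)
      also have "\<dots> = fact (S - 1 - i - j) / fact (S - n - j)"
      proof -
        have "n - 1 - i \<le> S - 1 - i - j" "S - 1 - i - j - (n - 1 - i) = S - n - j"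
          using assms True j by linarith+
        then show ?thesis by (simp only: ffall_of_nat if_True)
      qed
      finally show "(-1) ^ j * real (n choose j) * (ffall (real A - real j) i * (fact (S - 1 - i - j) / fact (S - n - j)))
        = (-1) ^ j * real (n choose j) * poly (p * q) (real j)" by (simp add: p q)
    qed
    also have "\<dots> = 0"
      using p(1) q(1) True degree_mult_le[of p q] by (intro alternating_binomial_sum_poly) linarith
    finally show ?thesis using True by simp
  next
    case False
    then have i: "i = n" using assms by simp
    define z where "z = real (S - n)"
    have zj: "z \<noteq> real j" if "j \<le> n" for j using that assms by (simp add: z_def)
    have "(\<Sum>j\<le>n. (-1) ^ j * real (n choose j) * (ffall (real A - real j) i * (fact (S - 1 - i - j) / fact (S - n - j))))
        = (\<Sum>j\<le>n. (-1) ^ j * real (n choose j) * ffall (real A - real j) n / (z - real j))"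
    proof (rule sum.cong[OF refl])
      fix j assume "j \<in> {..n}"
      then have "S - n - j = Suc (S - 1 - n - j)" "z - real j = real (S - n - j)"
        using assms by (auto simp: z_def of_nat_diff)
      then show "(-1) ^ j * real (n choose j) * (ffall (real A - real j) i * (fact (S - 1 - i - j) / fact (S - n - j)))
          = (-1) ^ j * real (n choose j) * ffall (real A - real j) n / (z - real j)"
        unfolding i by (simp del: of_nat_Suc)
    qed
    also have "\<dots> = ffall (real A - z) n * ((-1) ^ n * fact n / ffall z (Suc n))"
      using zj by (rule alternating_ffall_quotient)
    also have "ffall z (Suc n) = fact (S - n) / fact (S - 2 * n - 1)"
    proof -
      have "Suc n \<le> S - n" "S - n - Suc n = S - 2 * n - 1" using assms by linarith+
      then show ?thesis unfolding z_def by (simp only: ffall_of_nat if_True)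
    qed
    \<comment> \<open>The argument A - z = -(B + al - n + 1) is negative, so the falling factorial
      is a rising one up to sign.\<close>
    also have "ffall (real A - z) n = (-1) ^ n * (fact (B + al) / fact (B + al - n))"
    proof -
      have "ffall (real A - z) n = (-1) ^ n * pochhammer (real (B + al - n) + 1) n"
        unfolding ffall_pochhammer z_def using assms by (simp add: of_nat_diff algebra_simps)
      also have "pochhammer (real (B + al - n) + 1) n = fact (B + al) / fact (B + al - n)"
        using assms pochhammer_product[of "B + al - n" "B + al" "1 :: real"]
        by (simp add: pochhammer_fact[symmetric] add.commute)
      finally show ?thesis .
    qed
    finally have e: "(\<Sum>j\<le>n. (-1) ^ j * real (n choose j) * (ffall (real A - real j) i * (fact (S - 1 - i - j) / fact (S - n - j))))
        = (-1) ^ n * (fact (B + al) / fact (B + al - n)) * ((-1) ^ n * fact n / (fact (S - n) / fact (S - 2 * n - 1)))" .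
    have "((-1::real) ^ n) * (-1) ^ n = 1" by (simp flip: power_mult_distrib)
    then show ?thesis unfolding e unfolding C_def i by (simp add: field_simps)
  qed
  finally show ?thesis .
qed

text \<open>The factor of lower degree is expanded in \<open>ffall (A - x) i\<close> with i \<le> m.
  By the moments only i = n survives, which requires m = n and leaves the leading coefficient times
  \<open>H\<close>.\<close>

lemma hahn_poly_orthogonal_aux:
  assumes "m \<le> n" "n \<le> B" "B \<le> A" and S: "S = A + B + al + 1"
  shows "(\<Sum>x\<le>B. hahn_poly n A B S (real x) * hahn_poly m A B S (real x) * hahn_weight A B al x) =
    (if m = n then fact (S - n) / (real (S - 2 * n) * fact n * fact (A - n) * fact (B - n) *
       fact (A + al - n) * fact (B + al - n)) else 0)"
proof -
  define h where "h i = (\<Sum>x\<le>B. hahn_poly n A B S (real x) * ffall (real A - real x) i * hahn_weight A B al x)" for i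
  define H where "H = fact (S - 2 * n - 1) / (fact (A - n) * fact (B - n) * fact (A + al - n) * fact (B + al - n) :: real)"
  have h: "h i = (if i < n then 0 else H)" if "i \<le> n" for i
    unfolding h_def H_def using hahn_poly_moment[OF that assms(2,3) S] .
  obtain k where k: "\<And>j x. ffall x j = (\<Sum>i\<le>j. k j i * ffall (real A - x) i)" "\<And>j. k j j = (-1) ^ j"
    using ffall_reflect[of _ "real A"] by metis
  have "(\<Sum>x\<le>B. hahn_poly n A B S (real x) * hahn_poly m A B S (real x) * hahn_weight A B al x) =
      (\<Sum>x\<le>B. \<Sum>j\<le>m. \<Sum>i\<le>j. hahn_coeff m A B S j * k j i *
        (hahn_poly n A B S (real x) * ffall (real A - real x) i * hahn_weight A B al x))"
  proof (rule sum.cong[OF refl])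
    fix x
    have "hahn_poly m A B S (real x) = (\<Sum>j\<le>m. \<Sum>i\<le>j. hahn_coeff m A B S j * (k j i * ffall (real A - real x) i))"
      unfolding hahn_poly_def k(1)[of "real x"] sum_distrib_left ..
    then show "hahn_poly n A B S (real x) * hahn_poly m A B S (real x) * hahn_weight A B al x =
      (\<Sum>j\<le>m. \<Sum>i\<le>j. hahn_coeff m A B S j * k j i *
        (hahn_poly n A B S (real x) * ffall (real A - real x) i * hahn_weight A B al x))"
      by (simp only: sum_distrib_left sum_distrib_right mult_ac)
  qed
  also have "\<dots> = (\<Sum>j\<le>m. \<Sum>i\<le>j. hahn_coeff m A B S j * k j i * h i)"
    unfolding h_def sum_distrib_left by (subst sum.swap, rule sum.cong[OF refl], rule sum.swap)
  also have "\<dots> = (\<Sum>j\<le>m. \<Sum>i\<le>j. if i = n then hahn_coeff m A B S j * k j i * H else 0)"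
    using assms(1) by (intro sum.cong refl) (auto simp: h)
  also have "\<dots> = (\<Sum>j\<le>m. if j = n then hahn_coeff m A B S n * k n n * H else 0)"
    using assms(1) by (intro sum.cong refl) auto
  also have "\<dots> = (if m = n then hahn_coeff n A B S n * (-1) ^ n * H else 0)"
    using assms(1) by (auto simp: k(2))
  also have "hahn_coeff n A B S n * (-1) ^ n * H = fact (S - n) / (real (S - 2 * n) * fact n *
      fact (A - n) * fact (B - n) * fact (A + al - n) * fact (B + al - n))"
  proof -
    have e: "S - n - n = S - 2 * n" "S - 2 * n = Suc (S - 2 * n - 1)" using assms by linarith+
    have f: "fact (S - 2 * n) = real (S - 2 * n) * fact (S - 2 * n - 1)" by (metis e(2) fact_Suc)
    have "hahn_coeff n A B S n = (-1) ^ n * (fact (S - n) / fact (S - 2 * n)) / fact n"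
      using assms by (subst hahn_coeff_nat) (simp_all add: mult_2)
    then have "hahn_coeff n A B S n * (-1) ^ n = fact (S - n) / fact (S - 2 * n) / fact n"
      by (simp add: mult_ac flip: power_mult_distrib)
    then show ?thesis unfolding H_def f by simp
  qed
  finally show ?thesis .
qed

lemma hahn_poly_orthogonal:
  assumes "m \<le> B" "n \<le> B" "B \<le> A" and S: "S = A + B + al + 1"
  shows "(\<Sum>x\<le>B. hahn_poly n A B S (real x) * hahn_poly m A B S (real x) * hahn_weight A B al x) =
    (if m = n then fact (S - n) / (real (S - 2 * n) * fact n * fact (A - n) * fact (B - n) *
       fact (A + al - n) * fact (B + al - n)) else 0)"
proof (cases "m \<le> n")
  case True
  then show ?thesis using assms by (intro hahn_poly_orthogonal_aux)
next
  case False
  then show ?thesis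
    using hahn_poly_orthogonal_aux[of n m B A S al] assms by (simp add: mult.commute[of "hahn_poly n _ _ _ _"])
qed

section \<open>Transport of the Hahn functions along the walk\<close>

lemma inv_fact_of_nat: "inv_fact (int m) = 1 / fact m"
  by (simp add: inv_fact_def)

text \<open>True for every integer \<open>m\<close> thanks to the convention, as both sides vanish
  for m \<le> 0. Edges of the supports therefore need no separate treatment.\<close>

lemma inv_fact_minus_1: "inv_fact (m - 1) = real_of_int m * inv_fact m"
proof -
  consider "m < 0" | "m = 0" | "0 < m" by linarith
  then show ?thesis
  proof cases
    case 3
    then obtain k where m: "m = int (Suc k)" by (metis zero_less_imp_eq_int gr0_conv_Suc)
    have k: "int (Suc k) - 1 = int k" by simp
    show ?thesis unfolding m k inv_fact_of_nat by simp
  qed (simp_all add: inv_fact_def)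
qed

text \<open>\<open>par_A\<close>, \<open>par_B\<close> and \<open>par_S\<close> are N + \<beta>, N
  and 2N + \<alpha> + \<beta> + 1 for N = \<gamma>_s, \<alpha> = b_s, \<beta> = a_s. The formulas of
  adjacent phases agree at \<open>s = b\<close> and \<open>s = c\<close>.\<close>

definition par_A :: "nat \<Rightarrow> nat \<Rightarrow> nat \<Rightarrow> nat \<Rightarrow> real" where
  "par_A a b c s = (if s \<le> b then real a + real c - 1
     else if s \<le> c then real a + real b + real c - 1 - real s else real a + real b - 1)"

definition par_B :: "nat \<Rightarrow> nat \<Rightarrow> nat \<Rightarrow> nat \<Rightarrow> real" where
  "par_B a b c s = (if s \<le> b then real a + real s - 1
     else if s \<le> c then real a + real b - 1 else real a + real b + real c - 1 - real s)"

definition par_S :: "nat \<Rightarrow> nat \<Rightarrow> nat \<Rightarrow> real" where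
  "par_S a b c = 2 * real a + real b + real c - 1"

text \<open>Unnormalised Hahn functions. Each forward step yields the constant a + s - n, and the
  factorial is chosen to absorb it; \<open>hexF\<close> does the same for the constant a + b + c - r
  - 1 - n of a backward step.\<close>

definition hexE :: "nat \<Rightarrow> nat \<Rightarrow> nat \<Rightarrow> nat \<Rightarrow> nat \<Rightarrow> int \<Rightarrow> real" where
  "hexE a b c n s u = (if even (u - alpha_r a b c s) then
     let y = (u - alpha_r a b c s) div 2 in
       fact (a + s - 1 - n) * hahn_poly n (par_A a b c s) (par_B a b c s) (par_S a b c) (real_of_int y)
         * omega_tilde a b c s y
     else 0)"

definition hexF :: "nat \<Rightarrow> nat \<Rightarrow> nat \<Rightarrow> nat \<Rightarrow> nat \<Rightarrow> int \<Rightarrow> real" where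
  "hexF a b c n r u = (if even (u - alpha_r a b c r) then
     let x = (u - alpha_r a b c r) div 2 in
       fact (a + b + c - r - 1 - n) * hahn_poly n (par_A a b c r) (par_B a b c r) (par_S a b c) (real_of_int x)
         * omega_r a b c r x
     else 0)"

lemma hexE_at: "hexE a b c n s (alpha_r a b c s + 2 * y) = fact (a + s - 1 - n) *
    hahn_poly n (par_A a b c s) (par_B a b c s) (par_S a b c) (real_of_int y) * omega_tilde a b c s y"
  by (simp add: hexE_def)

lemma hexF_at: "hexF a b c n r (alpha_r a b c r + 2 * x) = fact (a + b + c - r - 1 - n) *
    hahn_poly n (par_A a b c r) (par_B a b c r) (par_S a b c) (real_of_int x) * omega_r a b c r x"
  by (simp add: hexF_def)

lemma omega_tilde_left:
  "s \<le> b \<Longrightarrow> omega_tilde a b c s y = inv_fact y * inv_fact (int s + int a - 1 - y)"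
  by (simp add: omega_tilde_def gamma_r_def Let_def)

text \<open>The cases before and after \<open>c\<close> merge, since \<gamma>_s + a_s = a + b - 1
  after \<open>c\<close>; at \<open>s = b\<close> the first case fits too, because b_s = 0.\<close>

lemma omega_tilde_right:
  assumes "b \<le> c" "b \<le> s" "s \<le> b + c"
  shows "omega_tilde a b c s y = inv_fact (int s - int b + y) * inv_fact (int a + int b - 1 - y)"
proof -
  have br: "int (b_r a b c s) = int s - int b" using assms by (simp add: b_r_def)
  consider "s = b" | "b < s" "s \<le> c" | "c < s" using assms(2) by linarith
  then show ?thesis
  proof cases
    case 3
    then have "int (a_r a b c s) = int s - int c" by (simp add: a_r_def)
    then show ?thesis using 3 assms by (simp add: omega_tilde_def gamma_r_def Let_def br algebra_simps)
  qed (use assms in \<open>simp_all add: omega_tilde_def gamma_r_def Let_def br algebra_simps\<close>)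
qed

lemma omega_left:
  assumes "b \<le> c" "r \<le> b"
  shows "omega_r a b c r x = inv_fact (int b - int r + x) * inv_fact (int a + int c - 1 - x)"
proof -
  have e: "int (a_r a b c r) = int c - int r" "int (b_r a b c r) = int b - int r"
    using assms by (simp_all add: a_r_def b_r_def)
  show ?thesis using assms by (simp add: omega_r_def gamma_r_def Let_def e algebra_simps)
qed

lemma omega_right:
  assumes "b \<le> c" "b \<le> r" "r \<le> b + c"
  shows "omega_r a b c r x = inv_fact x * inv_fact (int a + int b + int c - 1 - int r - x)"
proof -
  have ar: "int (a_r a b c r) = int c - int r" if "r \<le> c" using that by (simp add: a_r_def)
  have br: "int (b_r a b c r) = int r - int b" using assms by (simp add: b_r_def)
  consider "r = b" | "b < r" "r \<le> c" | "c < r" using assms(2) by linarith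
  then show ?thesis
  proof cases
    case 1
    then show ?thesis
      using assms by (simp add: omega_r_def gamma_r_def Let_def a_r_def b_r_def algebra_simps)
  qed (use assms in \<open>simp_all add: omega_r_def gamma_r_def Let_def ar br algebra_simps\<close>)
qed

lemma fact_diff_Suc:
  assumes "n < m"
  shows "fact (m - n) = (real m - real n) * fact (m - 1 - n)"
proof -
  have "m - n = Suc (m - 1 - n)" using assms by simp
  then have "fact (m - n) = real (m - n) * fact (m - 1 - n)" by (metis fact_Suc)
  then show ?thesis using assms by (simp add: of_nat_diff)
qed

text \<open>Before \<open>b\<close> the offset \<alpha> decreases, so the predecessors of
  \<open>y\<close> are \<open>y - 1\<close> and \<open>y\<close>, and the raising relation applies.
  From \<open>b\<close> on it increases, the predecessors are \<open>y\<close> and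
  \<open>y + 1\<close>, and the lowering relation applies: to \<open>A\<close> before
  \<open>c\<close>, to \<open>B\<close> afterwards. \<open>W\<close> is the common factor of the
  weights.\<close>

lemma hexE_step:
  assumes "b \<le> c" "n < a" "s < b + c"
  shows "hexE a b c n (Suc s) u = hexE a b c n s (u - 1) + hexE a b c n s (u + 1)"
proof (cases "even (u - alpha_r a b c (Suc s))")
  case False
  then have "odd (u - 1 - alpha_r a b c s)" "odd (u + 1 - alpha_r a b c s)"
    by (auto simp: alpha_r_def split: if_splits)
  with False show ?thesis by (simp add: hexE_def)
next
  case True
  then obtain y where "u - alpha_r a b c (Suc s) = 2 * y" by (rule evenE)
  then have u: "u = alpha_r a b c (Suc s) + 2 * y" by simp
  let ?R = "hahn_poly n (par_A a b c s) (par_B a b c s) (par_S a b c)"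
  let ?R' = "hahn_poly n (par_A a b c (Suc s)) (par_B a b c (Suc s)) (par_S a b c)"
  have f: "fact (a + Suc s - 1 - n) = (real a + real s - real n) * fact (a + s - 1 - n)"
    using fact_diff_Suc[of n "a + s"] assms by simp
  show ?thesis
  proof (cases "s < b")
    case True
    define W where "W = inv_fact y * inv_fact (int s + int a - y)"
    have al: "alpha_r a b c (Suc s) = alpha_r a b c s - 1" using True by (simp add: alpha_r_def)
    have p: "u - 1 = alpha_r a b c s + 2 * (y - 1)" "u + 1 = alpha_r a b c s + 2 * y"
      unfolding u al by simp_all
    have "inv_fact (int s + int a - 1 - y) = (real a + real s - real_of_int y) * inv_fact (int s + int a - y)"
      using inv_fact_minus_1[of "int s + int a - y"] by (simp add: algebra_simps)
    then have w: "omega_tilde a b c s y = (real a + real s - real_of_int y) * W"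
      using True by (simp add: omega_tilde_left W_def)
    have w': "omega_tilde a b c s (y - 1) = real_of_int y * W"
      using True by (simp add: omega_tilde_left W_def inv_fact_minus_1 algebra_simps)
    have w2: "omega_tilde a b c (Suc s) y = W" using True by (simp add: omega_tilde_left W_def)
    have "(par_B a b c s + 1 - real_of_int y) * ?R (real_of_int y) + real_of_int y * ?R (real_of_int y - 1)
        = (par_B a b c s + 1 - real n) * hahn_poly n (par_A a b c s) (par_B a b c s + 1) (par_S a b c) (real_of_int y)"
      by (rule hahn_poly_raise)
    moreover have "par_B a b c s = real a + real s - 1" "par_A a b c (Suc s) = par_A a b c s"
      "par_B a b c (Suc s) = par_B a b c s + 1" using True by (simp_all add: par_A_def par_B_def)
    ultimately have rel: "(real a + real s - real_of_int y) * ?R (real_of_int y) +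
        real_of_int y * ?R (real_of_int y - 1) = (real a + real s - real n) * ?R' (real_of_int y)"
      by simp
    show ?thesis
      unfolding p hexE_at unfolding u hexE_at w w' w2 f
      using arg_cong[OF rel, of "\<lambda>t. fact (a + s - 1 - n) * W * t"]
      by (simp add: algebra_simps)
  next
    case False
    define W where "W = inv_fact (int s - int b + y + 1) * inv_fact (int a + int b - 1 - y)"
    have al: "alpha_r a b c (Suc s) = alpha_r a b c s + 1" using False by (auto simp: alpha_r_def)
    have p: "u - 1 = alpha_r a b c s + 2 * y" "u + 1 = alpha_r a b c s + 2 * (y + 1)"
      unfolding u al by simp_all
    have "inv_fact (int s - int b + y) = (real s - real b + 1 + real_of_int y) * inv_fact (int s - int b + y + 1)"
      using inv_fact_minus_1[of "int s - int b + y + 1"] by (simp add: algebra_simps)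
    then have w: "omega_tilde a b c s y = (real s - real b + 1 + real_of_int y) * W"
      using False assms by (simp add: omega_tilde_right W_def)
    have "inv_fact (int a + int b - 1 - (y + 1)) = (real a + real b - 1 - real_of_int y) * inv_fact (int a + int b - 1 - y)"
      using inv_fact_minus_1[of "int a + int b - 1 - y"] by (simp add: algebra_simps)
    moreover have "omega_tilde a b c s (y + 1) = inv_fact (int s - int b + y + 1) * inv_fact (int a + int b - 1 - (y + 1))"
      using False assms by (simp add: omega_tilde_right add.assoc)
    ultimately have w': "omega_tilde a b c s (y + 1) = (real a + real b - 1 - real_of_int y) * W"
      by (simp only: W_def mult.left_commute)
    have w2: "omega_tilde a b c (Suc s) y = W" using False assms
      by (simp add: omega_tilde_right W_def algebra_simps)
    have rel: "(real s - real b + 1 + real_of_int y) * ?R (real_of_int y) +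
        (real a + real b - 1 - real_of_int y) * ?R (real_of_int y + 1) =
        (real a + real s - real n) * ?R' (real_of_int y)"
    proof (cases "s < c")
      case True
      then have "par_A a b c s = real a + real b + real c - 1 - real s" "par_B a b c s = real a + real b - 1"
        "par_A a b c (Suc s) = real a + real b + real c - 1 - real s - 1" "par_B a b c (Suc s) = real a + real b - 1"
        using False by (auto simp: par_A_def par_B_def)
      note par = this
      show ?thesis unfolding par by (rule hahn_poly_lower_left) (simp_all add: par_S_def)
    next
      case c: False
      then have "par_A a b c s = real a + real b - 1" "par_B a b c s = real a + real b + real c - 1 - real s"
        "par_A a b c (Suc s) = real a + real b - 1" "par_B a b c (Suc s) = real a + real b + real c - 1 - real s - 1"
        using False assms by (auto simp: par_A_def par_B_def)
      note par = this
      show ?thesis unfolding par by (rule hahn_poly_lower_right) (simp_all add: par_S_def)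
    qed
    show ?thesis
      unfolding p hexE_at unfolding u hexE_at w w' w2 f
      using arg_cong[OF rel, of "\<lambda>t. fact (a + s - 1 - n) * W * t"]
      by (simp add: algebra_simps)
  qed
qed

text \<open>Mirror image of \<open>hexE_step\<close>: going backward in time, lowering (of
  \<open>B\<close>) is used before \<open>b\<close> and raising afterwards, of \<open>A\<close> up
  to \<open>c\<close> and of \<open>B\<close> beyond.\<close>

lemma hexF_step:
  assumes "b \<le> c" "n < a" "r < b + c"
  shows "hexF a b c n r u = hexF a b c n (Suc r) (u + 1) + hexF a b c n (Suc r) (u - 1)"
proof (cases "even (u - alpha_r a b c r)")
  case False
  then have "odd (u - 1 - alpha_r a b c (Suc r))" "odd (u + 1 - alpha_r a b c (Suc r))"
    by (auto simp: alpha_r_def split: if_splits)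
  with False show ?thesis by (simp add: hexF_def)
next
  case True
  then obtain x where "u - alpha_r a b c r = 2 * x" by (rule evenE)
  then have u: "u = alpha_r a b c r + 2 * x" by simp
  let ?R' = "hahn_poly n (par_A a b c r) (par_B a b c r) (par_S a b c)"
  let ?R = "hahn_poly n (par_A a b c (Suc r)) (par_B a b c (Suc r)) (par_S a b c)"
  have "a + b + c - r - 1 - n = (a + b + c - r - 1) - n" "n < a + b + c - r - 1"
    "real (a + b + c - r - 1) = real a + real b + real c - 1 - real r"
    "a + b + c - Suc r - 1 - n = a + b + c - r - 1 - 1 - n"
    using assms by (auto simp: of_nat_diff)
  then have f: "fact (a + b + c - r - 1 - n) =
      (real a + real b + real c - 1 - real r - real n) * fact (a + b + c - Suc r - 1 - n)"
    using fact_diff_Suc[of n "a + b + c - r - 1"] by metis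
  show ?thesis
  proof (cases "r < b")
    case True
    define W where "W = inv_fact (int b - int r + x) * inv_fact (int a + int c - 1 - x)"
    have al: "alpha_r a b c r = alpha_r a b c (Suc r) + 1" using True by (simp add: alpha_r_def)
    have p: "u + 1 = alpha_r a b c (Suc r) + 2 * (x + 1)" "u - 1 = alpha_r a b c (Suc r) + 2 * x"
      unfolding u al by simp_all
    have "inv_fact (int b - int r - 1 + x) = (real b - real r + real_of_int x) * inv_fact (int b - int r + x)"
      using inv_fact_minus_1[of "int b - int r + x"] by (simp add: algebra_simps)
    moreover have "int b - int (Suc r) + x = int b - int r - 1 + x" by simp
    ultimately have w: "omega_r a b c (Suc r) x = (real b - real r + real_of_int x) * W"
      using True assms by (simp only: omega_left Suc_le_eq W_def mult.assoc)
    have "inv_fact (int a + int c - 1 - (x + 1)) = (real a + real c - 1 - real_of_int x) * inv_fact (int a + int c - 1 - x)"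
      using inv_fact_minus_1[of "int a + int c - 1 - x"] by (simp add: algebra_simps)
    moreover have "int b - int (Suc r) + (x + 1) = int b - int r + x" by simp
    ultimately have w': "omega_r a b c (Suc r) (x + 1) = (real a + real c - 1 - real_of_int x) * W"
      using True assms by (simp only: omega_left Suc_le_eq W_def mult.left_commute)
    have w2: "omega_r a b c r x = W" using True assms by (simp add: omega_left W_def)
    have par: "par_A a b c (Suc r) = real a + real c - 1" "par_B a b c (Suc r) = real a + real r"
      "par_A a b c r = real a + real c - 1" "par_B a b c r = real a + real r - 1"
      using True by (auto simp: par_A_def par_B_def)
    have rel: "(real b - real r + real_of_int x) * ?R (real_of_int x) +
        (real a + real c - 1 - real_of_int x) * ?R (real_of_int x + 1) =
        (real a + real b + real c - 1 - real r - real n) * ?R' (real_of_int x)"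
      unfolding par by (rule hahn_poly_lower_right) (simp_all add: par_S_def)
    show ?thesis
      unfolding p hexF_at unfolding u hexF_at w w' w2 f
      using arg_cong[OF rel, of "\<lambda>t. fact (a + b + c - Suc r - 1 - n) * W * t"]
      by (simp add: algebra_simps)
  next
    case False
    define M where "M = int a + int b + int c - 1 - int r"
    define W where "W = inv_fact x * inv_fact (M - x)"
    have al: "alpha_r a b c (Suc r) = alpha_r a b c r + 1" using False by (auto simp: alpha_r_def)
    have p: "u + 1 = alpha_r a b c (Suc r) + 2 * x" "u - 1 = alpha_r a b c (Suc r) + 2 * (x - 1)"
      unfolding u al by simp_all
    have w0: "omega_r a b c (Suc r) x' = inv_fact x' * inv_fact (M - 1 - x')" for x'
      using False assms by (simp add: omega_right M_def algebra_simps)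
    have "inv_fact (M - 1 - x) = (real_of_int M - real_of_int x) * inv_fact (M - x)"
      using inv_fact_minus_1[of "M - x"] by (simp add: algebra_simps)
    then have w: "omega_r a b c (Suc r) x = (real_of_int M - real_of_int x) * W"
      unfolding w0 by (simp add: W_def)
    have w': "omega_r a b c (Suc r) (x - 1) = real_of_int x * W"
      unfolding w0 by (simp add: W_def inv_fact_minus_1)
    have w2: "omega_r a b c r x = W"
      using False assms by (simp add: omega_right W_def M_def)
    have M: "real_of_int M = real a + real b + real c - 1 - real r" by (simp add: M_def)
    have rel: "(real_of_int M - real_of_int x) * ?R (real_of_int x) +
        real_of_int x * ?R (real_of_int x - 1) = (real a + real b + real c - 1 - real r - real n) * ?R' (real_of_int x)"
    proof (cases "r < c")
      case True
      then have par: "par_A a b c (Suc r) = real_of_int M - 1" "par_A a b c r = real_of_int M"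
        "par_B a b c r = par_B a b c (Suc r)"
        using False by (auto simp: par_A_def par_B_def M)
      show ?thesis unfolding par by (rule hahn_poly_raise_left) (simp_all add: M)
    next
      case c: False
      then have par: "par_B a b c (Suc r) = real_of_int M - 1" "par_A a b c r = par_A a b c (Suc r)"
        "par_B a b c r = real_of_int M"
        using False assms by (auto simp: par_A_def par_B_def M)
      show ?thesis unfolding par by (rule hahn_poly_raise_right) (simp_all add: M)
    qed
    show ?thesis
      unfolding p hexF_at unfolding u hexF_at w w' w2 f
      using arg_cong[OF rel, of "\<lambda>t. fact (a + b + c - Suc r - 1 - n) * W * t"]
      by (simp add: algebra_simps)
  qed
qed

lemma inv_fact_prod_support: "inv_fact y * inv_fact (int m - y) \<noteq> 0 \<Longrightarrow> 0 \<le> y \<and> y \<le> int m"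
  by (auto simp: inv_fact_def split: if_splits)

text \<open>At time 0 the weight is 1/(y! (a-1-y)!), which vanishes outside 0, ..., a - 1. At time b
  + c the weight of \<open>hexF\<close> has the same form.\<close>

lemma hexE_start:
  assumes "0 < a"
  shows "hexE a b c n 0 u = (\<Sum>j<a. hexE a b c n 0 (2 * int j) * of_bool (u = 2 * int j))"
proof (cases "\<exists>j<a. u = 2 * int j")
  case True
  then obtain j where j: "j < a" "u = 2 * int j" by blast
  have "(\<Sum>i<a. hexE a b c n 0 (2 * int i) * of_bool (u = 2 * int i)) =
      (\<Sum>i<a. if i = j then hexE a b c n 0 u else 0)"
    by (rule sum.cong[OF refl]) (auto simp: j(2))
  then show ?thesis using j(1) by simp
next
  case False
  have "hexE a b c n 0 u = 0"
  proof (rule ccontr)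
    assume nz: "hexE a b c n 0 u \<noteq> 0"
    then obtain y where u: "u = 2 * y" by (auto simp: hexE_def alpha_r_def elim!: evenE split: if_splits)
    then have "omega_tilde a b c 0 y \<noteq> 0" using nz by (auto simp: hexE_def alpha_r_def)
    then have "0 \<le> y \<and> y \<le> int (a - 1)"
      using assms by (intro inv_fact_prod_support) (simp add: omega_tilde_left of_nat_diff)
    then have "nat y < a" "u = 2 * int (nat y)" using assms u by auto
    then show False using False by blast
  qed
  then show ?thesis using False by simp
qed

lemma hexF_end:
  assumes "0 < a" "b \<le> c" "0 < c"
  shows "hexF a b c n (b + c) u =
    (\<Sum>j<a. hexF a b c n (b + c) (int c - int b + 2 * int j) * of_bool (u = int c - int b + 2 * int j))"
proof (cases "\<exists>j<a. u = int c - int b + 2 * int j")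
  case True
  then obtain j where j: "j < a" "u = int c - int b + 2 * int j" by blast
  have "(\<Sum>i<a. hexF a b c n (b + c) (int c - int b + 2 * int i) * of_bool (u = int c - int b + 2 * int i)) =
      (\<Sum>i<a. if i = j then hexF a b c n (b + c) u else 0)"
    by (rule sum.cong[OF refl]) (auto simp: j(2))
  then show ?thesis using j(1) by simp
next
  case False
  have al: "alpha_r a b c (b + c) = int c - int b" using assms by (auto simp: alpha_r_def)
  have "hexF a b c n (b + c) u = 0"
  proof (rule ccontr)
    assume nz: "hexF a b c n (b + c) u \<noteq> 0"
    then have "even (u - (int c - int b))" by (auto simp: hexF_def al split: if_splits)
    then obtain x where "u - (int c - int b) = 2 * x" by (rule evenE)
    then have u: "u = alpha_r a b c (b + c) + 2 * x" by (simp add: al)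
    then have "omega_r a b c (b + c) x \<noteq> 0" using nz by (auto simp: hexF_at)
    then have "0 \<le> x \<and> x \<le> int (a - 1)"
      using assms by (intro inv_fact_prod_support) (simp add: omega_right of_nat_diff)
    then have "nat x < a" "u = int c - int b + 2 * int (nat x)" using assms(1) u al by auto
    then show False using False by blast
  qed
  then show ?thesis using False by simp
qed

text \<open>Reciprocal of the pairing of \<open>hexE\<close> and \<open>hexF\<close> of equal index:
  the squared Hahn norm for N = a - 1, \<alpha> = b, \<beta> = c, multiplied by the two factorials
  at time 0.\<close>

definition hex_norm :: "nat \<Rightarrow> nat \<Rightarrow> nat \<Rightarrow> nat \<Rightarrow> real" where
  "hex_norm a b c n = real (2 * a + b + c - 1 - 2 * n) * fact n * fact (a + c - 1 - n) * fact (a + b - 1 - n)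
     / fact (2 * a + b + c - 1 - n)"

lemma hex_orthogonal:
  assumes "b \<le> c" "n < a" "m < a"
  shows "(\<Sum>j<a. hexE a b c n 0 (2 * int j) * hexF a b c m 0 (2 * int j)) * hex_norm a b c n = of_bool (n = m)"
proof -
  let ?A = "a + c - 1" and ?B = "a - 1" and ?S = "2 * a + b + c - 1"
  let ?R = "\<lambda>n. hahn_poly n ?A ?B ?S"
  have par: "par_A a b c 0 = real ?A" "par_B a b c 0 = real ?B" "par_S a b c = real ?S"
    using assms by (simp_all add: par_A_def par_B_def par_S_def of_nat_diff)
  have t: "hexE a b c n 0 (2 * int j) * hexF a b c m 0 (2 * int j) =
      fact (a - 1 - n) * fact (a + b + c - 1 - m) * (?R n (real j) * ?R m (real j) * hahn_weight ?A ?B b j)"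
    if "j < a" for j
  proof -
    have e: "hexE a b c n 0 (2 * int j) = fact (a - 1 - n) * ?R n (real j) * omega_tilde a b c 0 (int j)"
      using hexE_at[of a b c n 0 "int j"] by (simp add: alpha_r_def par)
    have f: "hexF a b c m 0 (2 * int j) = fact (a + b + c - 1 - m) * ?R m (real j) * omega_r a b c 0 (int j)"
      using hexF_at[of a b c m 0 "int j"] by (simp add: alpha_r_def par)
    have n: "int a - 1 - int j = int (a - 1 - j)" "int b + int j = int (b + j)"
      "int a + int c - 1 - int j = int (a + c - 1 - j)"
      using that by (simp_all add: of_nat_diff)
    have "omega_tilde a b c 0 (int j) = inv_fact (int j) * inv_fact (int (a - 1 - j))"
      using omega_tilde_left[of 0 b a c "int j"] by (simp only: of_nat_0 add_0 n le0 simp_thms)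
    moreover have "omega_r a b c 0 (int j) = inv_fact (int (b + j)) * inv_fact (int (a + c - 1 - j))"
      using omega_left[OF assms(1), of 0 a "int j"] by (simp only: of_nat_0 diff_zero n le0 simp_thms)
    ultimately have "omega_tilde a b c 0 (int j) * omega_r a b c 0 (int j) = hahn_weight ?A ?B b j"
      by (simp add: inv_fact_of_nat hahn_weight_def del: of_nat_add)
    then show ?thesis unfolding e f by (simp add: mult_ac)
  qed
  have "{..<a} = {..?B}" using assms by auto
  then have "(\<Sum>j<a. hexE a b c n 0 (2 * int j) * hexF a b c m 0 (2 * int j)) =
      fact (a - 1 - n) * fact (a + b + c - 1 - m) * (\<Sum>j\<le>?B. ?R n (real j) * ?R m (real j) * hahn_weight ?A ?B b j)"
    unfolding sum_distrib_left using t by (intro sum.cong) auto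
  also have "(\<Sum>j\<le>?B. ?R n (real j) * ?R m (real j) * hahn_weight ?A ?B b j) =
      (if m = n then fact (?S - n) / (real (?S - 2 * n) * fact n * fact (?A - n) * fact (?B - n) *
       fact (?A + b - n) * fact (?B + b - n)) else 0)"
    using assms by (intro hahn_poly_orthogonal) auto
  finally show ?thesis
  proof (cases "m = n")
    case True
    have "?A + b - n = a + b + c - 1 - n" "?B + b - n = a + b - 1 - n" using assms by auto
    moreover have "real (?S - 2 * n) \<noteq> 0" using assms by simp
    moreover assume "(\<Sum>j<a. hexE a b c n 0 (2 * int j) * hexF a b c m 0 (2 * int j)) =
      fact (a - 1 - n) * fact (a + b + c - 1 - m) *
      (if m = n then fact (?S - n) / (real (?S - 2 * n) * fact n * fact (?A - n) * fact (?B - n) *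
       fact (?A + b - n) * fact (?B + b - n)) else 0)"
    ultimately show ?thesis using True by (simp add: hex_norm_def)
  qed simp
qed

section \<open>Identification of the kernel\<close>

lemma hahn_q_eq:
  assumes "n \<le> N"
  shows "hahn_q al be n N x = hahn_poly n (real N + real be) (real N)
    (2 * real N + real al + real be + 1) x / hahn_d al be n N"
proof -
  have nz: "pochhammer (- real N - real be) j \<noteq> 0" "pochhammer (- real N) j \<noteq> 0" if "j \<le> n" for j
    using that assms by (auto simp: pochhammer_eq_0_iff)
  have "pochhammer (- real N - real be) n * pochhammer (- real N) n / (hahn_d al be n N * fact n) *
      (real (n choose j) * (-1) ^ j * (pochhammer (- x) j * pochhammer (real n - 2 * real N - real al - real be - 1) j)
        / (pochhammer (- real N - real be) j * pochhammer (- real N) j)) =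
      hahn_coeff n (real N + real be) (real N) (2 * real N + real al + real be + 1) j * ffall x j / hahn_d al be n N"
    if j: "j \<le> n" for j
  proof -
    have p1: "pochhammer (- real N - real be) n =
        pochhammer (- real N - real be) j * pochhammer (real j - (real N + real be)) (n - j)"
      using pochhammer_product[OF j, of "- real N - real be"] by (simp add: algebra_simps)
    have p2: "pochhammer (- real N) n = pochhammer (- real N) j * pochhammer (real j - real N) (n - j)"
      using pochhammer_product[OF j, of "- real N"] by (simp add: algebra_simps)
    have p3: "real (n choose j) = fact n / (fact j * fact (n - j))" using j by (rule binomial_fact)
    have p4: "real n - 2 * real N - real al - real be - 1 = real n - (2 * real N + real al + real be + 1)"
      by simp
    show ?thesis unfolding p4 unfolding p1 p2 p3 hahn_coeff_def ffall_pochhammer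
      using nz[OF j] by (simp add: mult_ac)
  qed
  then show ?thesis
    unfolding hahn_q_def hahn_poly_def sum_distrib_left sum_divide_distrib atLeast0AtMost
    by (intro sum.cong) auto
qed

text \<open>In each phase the four numbers \<alpha>+\<beta>+N-n, \<beta>+N-n, \<alpha>+N-n and N-n
  are a+c-1-n, a+b-1-n, a+s-1-n and a+b+c-s-1-n in some order. The first two of these and the
  remaining factors do not depend on \<open>s\<close> and form \<open>hex_norm\<close>.\<close>

lemma hahn_d_eq:
  assumes "n < a" "b \<le> c" "s \<le> b + c"
  shows "hahn_d (b_r a b c s) (a_r a b c s) n (nat (gamma_r a b c s)) =
    sqrt (1 / (hex_norm a b c n * fact (a + s - 1 - n) * fact (a + b + c - s - 1 - n)))"
proof -
  define N where "N = nat (gamma_r a b c s)"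
  define al where "al = b_r a b c s"
  define be where "be = a_r a b c s"
  let ?S = "2 * a + b + c - 1"
  have S: "al + be + 2 * N + 1 = ?S" and nN: "n \<le> N"
    using assms by (auto simp: al_def be_def N_def b_r_def a_r_def gamma_r_def)
  have p1: "pochhammer (real (al + be + N - n) + 1) (N + 1) = fact (?S - n) / fact (al + be + N - n)"
  proof -
    have "?S - n = (al + be + N - n) + (N + 1)" using S nN by linarith
    then show ?thesis
      using pochhammer_product[of "al + be + N - n" "?S - n" "1 :: real"]
      by (simp add: pochhammer_fact[symmetric] add.commute)
  qed
  have p2: "real (al + be + N - n) + 1 = real al + real be + real N + 1 - real n"
    using nN by (simp add: of_nat_diff)
  have p3: "real al + real be + 2 * real N + 1 - 2 * real n = real (?S - 2 * n)"
    using S nN by (simp add: of_nat_diff flip: S)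
  have "hahn_d al be n N = sqrt (fact (?S - n) / fact (al + be + N - n) /
      (real (?S - 2 * n) * fact n * fact (be + N - n) * fact (al + N - n) * fact (N - n)))"
    unfolding hahn_d_def p2[symmetric] p1 p3 ..
  also have "fact (?S - n) / fact (al + be + N - n) /
      (real (?S - 2 * n) * fact n * fact (be + N - n) * fact (al + N - n) * fact (N - n)) =
      (1 / (hex_norm a b c n * fact (a + s - 1 - n) * fact (a + b + c - s - 1 - n)) :: real)"
  proof -
    consider "s \<le> b" | "b < s" "s \<le> c" | "c < s" by linarith
    then have "fact (al + be + N - n) * (fact (be + N - n) * (fact (al + N - n) * fact (N - n))) =
      (fact (a + c - 1 - n) * (fact (a + b - 1 - n) * (fact (a + s - 1 - n) * fact (a + b + c - s - 1 - n))) :: real)"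
    proof cases
      case 1
      then have "al + be + N - n = a + b + c - s - 1 - n" "be + N - n = a + c - 1 - n"
        "al + N - n = a + b - 1 - n" "N - n = a + s - 1 - n"
        using assms by (auto simp: al_def be_def N_def b_r_def a_r_def gamma_r_def)
      then show ?thesis by (simp only: mult_ac)
    next
      case 2
      then have "al + be + N - n = a + c - 1 - n" "be + N - n = a + b + c - s - 1 - n"
        "al + N - n = a + s - 1 - n" "N - n = a + b - 1 - n"
        using assms by (auto simp: al_def be_def N_def b_r_def a_r_def gamma_r_def)
      then show ?thesis by (simp only: mult_ac)
    next
      case 3
      then have "al + be + N - n = a + s - 1 - n" "be + N - n = a + b - 1 - n"
        "al + N - n = a + c - 1 - n" "N - n = a + b + c - s - 1 - n"
        using assms by (auto simp: al_def be_def N_def b_r_def a_r_def gamma_r_def)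
      then show ?thesis by (simp only: mult_ac)
    qed
    from arg_cong[OF this, of "\<lambda>t. fact (?S - n) / (real (?S - 2 * n) * fact n * t)"]
    show ?thesis unfolding hex_norm_def by (simp add: mult_ac)
  qed
  finally show ?thesis by (simp add: al_def be_def N_def)
qed

lemma K_H_eq:
  assumes "0 < a" "b \<le> c" "r \<le> b + c" "s \<le> b + c"
    and "even (u - alpha_r a b c r)" "even (v - alpha_r a b c s)"
  shows "K_H a b c r u s v = - phi_rs r s u v + (\<Sum>n<a. hexF a b c n r u * hex_norm a b c n * hexE a b c n s v)"
proof -
  define x where "x = (u - alpha_r a b c r) div 2"
  define y where "y = (v - alpha_r a b c s) div 2"
  have par: "real (nat (gamma_r a b c t)) + real (a_r a b c t) = par_A a b c t"
    "real (nat (gamma_r a b c t)) = par_B a b c t"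
    "2 * real (nat (gamma_r a b c t)) + real (b_r a b c t) + real (a_r a b c t) + 1 = par_S a b c"
    "a - 1 \<le> nat (gamma_r a b c t)"
    if "t \<le> b + c" for t
    using that assms(1,2)
    by (auto simp: gamma_r_def a_r_def b_r_def par_A_def par_B_def par_S_def of_nat_diff nat_diff_distrib)
  have "sqrt (fact (a + s - 1 - n) * fact (a + b + c - r - 1 - n) / (fact (a + r - 1 - n) * fact (a + b + c - s - 1 - n)))
      * hahn_q (b_r a b c r) (a_r a b c r) n (nat (gamma_r a b c r)) (real_of_int x)
      * hahn_q (b_r a b c s) (a_r a b c s) n (nat (gamma_r a b c s)) (real_of_int y)
      * omega_r a b c r x * omega_tilde a b c s y = hexF a b c n r u * hex_norm a b c n * hexE a b c n s v"
    if n: "n < a" for n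
  proof -
    define Xr Yr Xs Ys C :: real where "Xr = fact (a + r - 1 - n)" and "Yr = fact (a + b + c - r - 1 - n)"
      and "Xs = fact (a + s - 1 - n)" and "Ys = fact (a + b + c - s - 1 - n)" and "C = hex_norm a b c n"
    have pos: "0 < Xr" "0 < Yr" "0 < Xs" "0 < Ys" "0 < C"
      using n by (simp_all add: Xr_def Yr_def Xs_def Ys_def C_def hex_norm_def)
    \<comment> \<open>The square-root prefactor and the two normalisations combine to the rational
      number C Xs Yr: \<open>Xs\<close> belongs to \<open>hexE\<close>, \<open>Yr\<close> to
      \<open>hexF\<close>, and \<open>C\<close> is \<open>hex_norm\<close>.\<close>
    have "sqrt (Xs * Yr / (Xr * Ys)) * sqrt (C * Xr * Yr) * sqrt (C * Xs * Ys) = sqrt ((C * Xs * Yr)\<^sup>2)"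
      unfolding real_sqrt_mult[symmetric] using pos by (intro arg_cong[where f = sqrt]) (simp add: field_simps power2_eq_square)
    then have "sqrt (Xs * Yr / (Xr * Ys)) / (sqrt (1 / (C * Xr * Yr)) * sqrt (1 / (C * Xs * Ys))) = C * Xs * Yr"
      using pos by (simp add: real_sqrt_divide)
    then have sq: "sqrt (Xs * Yr / (Xr * Ys)) * (1 / sqrt (1 / (C * Xr * Yr))) * (1 / sqrt (1 / (C * Xs * Ys))) = C * Xs * Yr"
      by simp
    have q: "hahn_q (b_r a b c t) (a_r a b c t) n (nat (gamma_r a b c t)) z =
        hahn_poly n (par_A a b c t) (par_B a b c t) (par_S a b c) z *
        (1 / sqrt (1 / (C * fact (a + t - 1 - n) * fact (a + b + c - t - 1 - n))))" if "t \<le> b + c" for t z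
    proof -
      have "n \<le> nat (gamma_r a b c t)" using par(4)[OF that] n by simp
      then show ?thesis
        unfolding C_def hahn_d_eq[OF n assms(2) that, symmetric] par(1,3)[OF that, symmetric]
        unfolding par(2)[OF that, symmetric] by (simp add: hahn_q_eq)
    qed
    have E: "hexE a b c n s v = Xs * hahn_poly n (par_A a b c s) (par_B a b c s) (par_S a b c) y * omega_tilde a b c s y"
      using assms(6) by (simp add: hexE_def y_def Xs_def Let_def)
    have F: "hexF a b c n r u = Yr * hahn_poly n (par_A a b c r) (par_B a b c r) (par_S a b c) x * omega_r a b c r x"
      using assms(5) by (simp add: hexF_def x_def Yr_def Let_def)
    show ?thesis
      unfolding q[OF assms(3)] q[OF assms(4)] E F Xr_def[symmetric] Yr_def[symmetric] Xs_def[symmetric]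
        Ys_def[symmetric] C_def[symmetric]
      using arg_cong[OF sq, of "\<lambda>t. t * hahn_poly n (par_A a b c s) (par_B a b c s) (par_S a b c) y *
        hahn_poly n (par_A a b c r) (par_B a b c r) (par_S a b c) x * omega_r a b c r x * omega_tilde a b c s y"]
      by (simp only: mult_ac)
  qed
  then show ?thesis
    using assms(5,6) unfolding K_H_def x_def y_def Let_def by simp
qed

section \<open>The correlation functions\<close>

lemma nip_to_parity:
  assumes "z \<in> nip_to a T y" "j < a" "r \<le> T"
  shows "even (z r j - int r)"
  using assms(3)
proof (induction r)
  case 0
  have "z 0 j = 2 * int j" using assms(1,2) unfolding nip_to_def by blast
  then show ?case by simp
next
  case (Suc r)
  then have "\<bar>z (Suc r) j - z r j\<bar> = 1" using assms(1,2) unfolding nip_to_def by (simp add: Suc_le_eq)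
  moreover have "even (z r j - int r)" using Suc by simp
  ultimately show ?case by presburger
qed

text \<open>The sign is absorbed into the rows in \<open>I\<close>, which become those of K - 1
  while the others are those of 1. Multilinearity then yields the determinant of (K - 1) +
  1.\<close>

lemma sum_signed_rows:
  fixes K :: "nat \<Rightarrow> nat \<Rightarrow> real"
  shows "(\<Sum>I\<in>Pow {..<k}. (-1) ^ card I * det (mat k k (\<lambda>(i, j). of_bool (i = j) - (if i \<in> I then K i j else 0)))) =
    det (mat k k (\<lambda>(i, j). K i j))"
proof -
  have "(-1) ^ card I * det (mat k k (\<lambda>(i, j). of_bool (i = j) - (if i \<in> I then K i j else 0))) =
      det (mat k k (\<lambda>(i, j). if i \<in> I then K i j - of_bool (i = j) else of_bool (i = j)))"
    if "I \<in> Pow {..<k}" for I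
  proof -
    have "(\<Prod>i<k. if i \<in> I then -1 else 1 :: real) = (-1) ^ card I"
      using that by (simp add: prod.If_cases Int_absorb1)
    then show ?thesis
      by (simp only: det_mat_scale_rows[of k "\<lambda>i. if i \<in> I then -1 else 1", symmetric] flip: \<open>_ = (-1) ^ card I\<close>)
        (intro arg_cong[where f = det] eq_matI, auto)
  qed
  then have "(\<Sum>I\<in>Pow {..<k}. (-1) ^ card I * det (mat k k (\<lambda>(i, j). of_bool (i = j) - (if i \<in> I then K i j else 0)))) =
      (\<Sum>I\<in>Pow {..<k}. det (mat k k (\<lambda>(i, j). if i \<in> I then K i j - of_bool (i = j) else of_bool (i = j))))"
    by (rule sum.cong[OF refl])
  also have "\<dots> = det (mat k k (\<lambda>(i, j). (K i j - of_bool (i = j)) + of_bool (i = j)))"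
    by (rule det_mat_add_rows[symmetric])
  finally show ?thesis by simp
qed

lemma of_bool_ball_inclusion_exclusion:
  assumes "finite A"
  shows "(of_bool (\<forall>i\<in>A. P i) :: real) = (\<Sum>I\<in>Pow A. (-1) ^ card I * of_bool (\<forall>i\<in>I. \<not> P i))"
proof -
  have "(of_bool (\<forall>i\<in>A. P i) :: real) = (\<Prod>i\<in>A. (of_bool (P i) - 1) + 1)"
    using assms by (auto simp: prod_zero_iff)
  also have "\<dots> = (\<Sum>I\<in>Pow A. \<Prod>i\<in>A. if i \<in> I then of_bool (P i) - 1 else 1)"
    by (rule prod_add_if[OF assms])
  also have "\<dots> = (\<Sum>I\<in>Pow A. (-1) ^ card I * of_bool (\<forall>i\<in>I. \<not> P i))"
  proof (rule sum.cong[OF refl])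
    fix I assume "I \<in> Pow A"
    then have I: "I \<subseteq> A" "finite I" using assms finite_subset by auto
    have "(\<Prod>i\<in>A. if i \<in> I then of_bool (P i) - 1 else 1 :: real) = (\<Prod>i\<in>I. of_bool (P i) - 1)"
      using assms I by (simp add: prod.If_cases Int_absorb1)
    also have "\<dots> = (\<Prod>i\<in>I. -1 * of_bool (\<not> P i))" by (rule prod.cong) auto
    also have "\<dots> = (-1) ^ card I * (\<Prod>i\<in>I. of_bool (\<not> P i))" by (simp only: prod.distrib prod_constant)
    also have "(\<Prod>i\<in>I. of_bool (\<not> P i) :: real) = of_bool (\<forall>i\<in>I. \<not> P i)"
      using I by (auto simp: prod_zero_iff)
    finally show "(\<Prod>i\<in>A. if i \<in> I then of_bool (P i) - 1 else 1 :: real) = (-1) ^ card I * of_bool (\<forall>i\<in>I. \<not> P i)" .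
  qed
  finally show ?thesis .
qed

lemma mat_mult_sum:
  fixes f g :: "nat \<Rightarrow> nat \<Rightarrow> real"
  shows "mat n m (\<lambda>(i, j). f i j) * mat m l (\<lambda>(i, j). g i j) = mat n l (\<lambda>(i, j). \<Sum>t<m. f i t * g t j)"
  by (rule eq_matI) (auto simp: scalar_prod_def atLeast0LessThan)

text \<open>The kernel is \<open>H A\<inverse> G - \<phi>\<close>, where \<open>A\<close>, \<open>G\<close>, \<open>H\<close> and \<open>\<phi>\<close> count the paths from start
  to end points, from start points to \<open>p\<close>, from \<open>p\<close> to end points and between points of \<open>p\<close>;
  the biorthogonality assumption provides the factorisation of \<open>A\<inverse>\<close>.\<close>

lemma det_avoid:
  fixes p :: "nat \<Rightarrow> nat \<times> int" and M N :: "nat \<Rightarrow> nat \<Rightarrow> real" and C :: "nat \<Rightarrow> real"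
    and T a k :: nat and y :: "nat \<Rightarrow> int"
  defines "A \<equiv> (\<lambda>i j. path_count T (y j - 2 * int i))"
  assumes inj: "inj_on p {..<k}" and time: "\<And>l. l < k \<Longrightarrow> fst (p l) < T" and I: "I \<subseteq> {..<k}"
    and biorth: "\<And>n m. n < a \<Longrightarrow> m < a \<Longrightarrow>
      C n * (\<Sum>i<a. M n i * (\<Sum>j<a. A i j * N m j)) = of_bool (n = m)"
    and E: "\<And>n l. n < a \<Longrightarrow> l < k \<Longrightarrow> E n l = (\<Sum>i<a. M n i * path_count (fst (p l)) (snd (p l) - 2 * int i))"
    and F: "\<And>n l. n < a \<Longrightarrow> l < k \<Longrightarrow> F n l = (\<Sum>j<a. N n j * path_count (T - fst (p l)) (y j - snd (p l)))"
    and K: "\<And>l l'. l < k \<Longrightarrow> l' < k \<Longrightarrow>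
      K l l' = - phi_rs (fst (p l)) (fst (p l')) (snd (p l)) (snd (p l')) + (\<Sum>n<a. F n l * C n * E n l')"
  shows "det (mat a a (\<lambda>(i, j). A i j)) \<noteq> 0"
    and "det (mat a a (\<lambda>(i, j). walk_wt (avoid (p ` I)) T (2 * int i) (y j))) =
      det (mat a a (\<lambda>(i, j). A i j)) *
      det (mat k k (\<lambda>(l, l'). of_bool (l = l') - (if l \<in> I then K l l' else 0)))"
proof -
  let ?W = "walk_wt (avoid (p ` I))"
  let ?phi = "\<lambda>l l'. phi_rs (fst (p l)) (fst (p l')) (snd (p l)) (snd (p l'))"
  define Am where "Am = mat a a (\<lambda>(i, j). A i j)"
  define X where "X = mat a a (\<lambda>(n, i). C n * M n i)"
  define Y where "Y = mat a a (\<lambda>(j, m). N m j)"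
  define Gt where "Gt = mat a k (\<lambda>(i, l). ?W (fst (p l)) (2 * int i) (snd (p l)))"
  define G where "G = mat a k (\<lambda>(i, l). path_count (fst (p l)) (snd (p l) - 2 * int i))"
  \<comment> \<open>Rows outside \<open>I\<close> are set to zero instead of being removed, so that
    all determinants have size \<open>k\<close>, as \<open>sum_signed_rows\<close> expects.\<close>
  define L where "L = mat k a (\<lambda>(l, j). if l \<in> I then path_count (T - fst (p l)) (y j - snd (p l)) else 0)"
  define P where "P = mat k k (\<lambda>(l, l'). if l \<in> I then ?phi l l' else 0)"
  have c: "Am \<in> carrier_mat a a" "X \<in> carrier_mat a a" "Y \<in> carrier_mat a a" "Gt \<in> carrier_mat a k"
    "G \<in> carrier_mat a k" "L \<in> carrier_mat k a" "P \<in> carrier_mat k k" "Y * X \<in> carrier_mat a a"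
    by (auto simp: Am_def X_def Y_def Gt_def G_def L_def P_def)
  have "X * (Am * Y) = 1\<^sub>m a"
    unfolding X_def Am_def Y_def mat_mult_sum using biorth
    by (intro eq_matI) (auto simp: mult.assoc simp flip: sum_distrib_left)
  then have "Am * Y * X = 1\<^sub>m a"
    using mat_mult_left_right_inverse[OF c(2) mult_carrier_mat[OF c(1,3)]] by simp
  \<comment> \<open>The inverse of \<open>Am\<close> is \<open>Y * X\<close>; thus
    \<open>L * Y\<close> and \<open>X * G\<close> below are the Hahn functions evaluated at the
    points.\<close>
  then have AB: "Am * (Y * X) = 1\<^sub>m a" using assoc_mult_mat[OF c(1,3,2)] by simp
  have "det Am * det (Y * X) = 1" using det_mult[OF c(1,8)] AB by simp
  then show "det (mat a a (\<lambda>(i, j). A i j)) \<noteq> 0" unfolding Am_def by auto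
  have W: "?W r v u = path_count r (u - v) -
      (\<Sum>l<k. if l \<in> I then ?W (fst (p l)) v (snd (p l)) * phi_rs (fst (p l)) r (snd (p l)) u else 0)" for r v u
  proof -
    have "finite I" using I finite_subset by blast
    moreover have "inj_on p I" using inj I by (rule inj_on_subset)
    ultimately have "?W r v u = path_count r (u - v) -
      (\<Sum>l\<in>I. ?W (fst (p l)) v (snd (p l)) * phi_rs (fst (p l)) r (snd (p l)) u)"
      by (subst walk_wt_avoid) (simp_all add: sum.reindex)
    also have "(\<Sum>l\<in>I. ?W (fst (p l)) v (snd (p l)) * phi_rs (fst (p l)) r (snd (p l)) u) =
      (\<Sum>l<k. if l \<in> I then ?W (fst (p l)) v (snd (p l)) * phi_rs (fst (p l)) r (snd (p l)) u else 0)"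
      using I by (intro sum.mono_neutral_cong_left) auto
    finally show ?thesis .
  qed
  \<comment> \<open>The first-visit decomposition \<open>W\<close>, evaluated at the points of
    \<open>p\<close> themselves.\<close>
  have GP: "Gt * (1\<^sub>m k + P) = G"
  proof -
    have "Gt * P = mat a k (\<lambda>(i, l'). \<Sum>l<k. if l \<in> I then ?W (fst (p l)) (2 * int i) (snd (p l)) * ?phi l l' else 0)"
      unfolding Gt_def P_def mat_mult_sum by (intro eq_matI) (auto intro!: sum.cong)
    then have "Gt + Gt * P = G"
      unfolding Gt_def G_def using W[of "fst (p _)" _ "snd (p _)"] by (intro eq_matI) auto
    then show ?thesis using mult_add_distrib_mat[OF c(4) one_carrier_mat c(7)] right_mult_one_mat[OF c(4)] by simp
  qed
  have At: "mat a a (\<lambda>(i, j). ?W T (2 * int i) (y j)) = Am - Gt * L"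
  proof -
    have "Gt * L = mat a a (\<lambda>(i, j). \<Sum>l<k. if l \<in> I then ?W (fst (p l)) (2 * int i) (snd (p l)) *
        phi_rs (fst (p l)) T (snd (p l)) (y j) else 0)"
      unfolding Gt_def L_def mat_mult_sum using time
      by (intro eq_matI) (auto intro!: sum.cong simp: phi_rs_eq not_le[symmetric])
    then show ?thesis unfolding Am_def A_def by (intro eq_matI) (auto simp: W[of T])
  qed
  have "1\<^sub>m k + P = mat k k (\<lambda>(l, l'). of_bool (l = l') + (if l \<in> I then ?phi l l' else 0))"
    unfolding P_def by (intro eq_matI) auto
  also have "det \<dots> = 1"
    by (rule det_one_plus_strict[where t = "\<lambda>l. fst (p l)"]) (auto simp: phi_rs_def)
  finally have detP: "det (1\<^sub>m k + P) = 1" .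
  have "L * (Y * X) * G = (L * Y) * (X * G)"
    using assoc_mult_mat[OF c(6,3,2)] assoc_mult_mat[OF mult_carrier_mat[OF c(6,3)] c(2,5)] by simp
  also have "\<dots> = mat k k (\<lambda>(l, l'). if l \<in> I then \<Sum>n<a. F n l * C n * E n l' else 0)"
  proof -
    have "L * Y = mat k a (\<lambda>(l, n). if l \<in> I then F n l else 0)"
      unfolding L_def Y_def mat_mult_sum by (intro eq_matI) (auto simp: F mult.commute)
    moreover have "X * G = mat a k (\<lambda>(n, l). C n * E n l)"
      unfolding X_def G_def mat_mult_sum by (intro eq_matI) (auto simp: E sum_distrib_left mult.assoc)
    ultimately show ?thesis
      by (simp only: mat_mult_sum) (intro eq_matI, auto simp: mult.assoc intro!: sum.cong)
  qed
  finally have LYXG: "L * (Y * X) * G = mat k k (\<lambda>(l, l'). if l \<in> I then \<Sum>n<a. F n l * C n * E n l' else 0)" .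
  have "1\<^sub>m k + P - L * (Y * X) * G = mat k k (\<lambda>(l, l'). of_bool (l = l') - (if l \<in> I then K l l' else 0))"
    unfolding LYXG unfolding P_def by (intro eq_matI) (auto simp: K)
  then show "det (mat a a (\<lambda>(i, j). ?W T (2 * int i) (y j))) = det (mat a a (\<lambda>(i, j). A i j)) *
      det (mat k k (\<lambda>(l, l'). of_bool (l = l') - (if l \<in> I then K l l' else 0)))"
    using det_update[OF c(1,8) AB c(4,6,7) detP At] unfolding GP Am_def by simp
qed

text \<open>With the 0/1 weights \<open>avoid\<close> the product over times and particles is the
  indicator of avoidance. Hypothesis \<open>time\<close> is what puts every point among the counted
  times r < T.\<close>

lemma sum_nip_to_avoid_eq_det:
  assumes "\<And>j. a \<le> j \<Longrightarrow> y j = 0" "\<And>j. Suc j < a \<Longrightarrow> y j \<le> y (Suc j)" "\<And>j. j < a \<Longrightarrow> even (y j - int T)"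
    and time: "\<And>i. i \<in> I \<Longrightarrow> fst (p i) < T"
  shows "(\<Sum>z\<in>nip_to a T y. of_bool (\<forall>i\<in>I. \<not> (\<exists>j<a. z (fst (p i)) j = snd (p i)))) =
    det (mat a a (\<lambda>(i, j). walk_wt (avoid (p ` I)) T (2 * int i) (y j)))"
proof -
  have "(of_bool (\<forall>i\<in>I. \<not> (\<exists>j<a. z (fst (p i)) j = snd (p i))) :: real) =
      (\<Prod>r<T. \<Prod>j<a. avoid (p ` I) r (z r j))" for z
  proof (cases "\<forall>i\<in>I. \<not> (\<exists>j<a. z (fst (p i)) j = snd (p i))")
    case True
    have "avoid (p ` I) r (z r j) = 1" if "j < a" for r j
    proof -
      have "(r, z r j) \<notin> p ` I"
      proof
        assume "(r, z r j) \<in> p ` I"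
        then obtain i where "i \<in> I" "p i = (r, z r j)" by (metis imageE)
        then show False using True that by (metis fst_conv snd_conv)
      qed
      then show ?thesis by (simp add: avoid_def)
    qed
    then show ?thesis using True by simp
  next
    case False
    then obtain i j where ij: "i \<in> I" "j < a" "z (fst (p i)) j = snd (p i)" by blast
    then have "avoid (p ` I) (fst (p i)) (z (fst (p i)) j) = 0" by (auto simp: avoid_def)
    then have "(\<Prod>j<a. avoid (p ` I) (fst (p i)) (z (fst (p i)) j)) = 0"
      using ij(2) by (intro prod_zero bexI[of _ j]) auto
    then have "\<exists>r\<in>{..<T}. (\<Prod>j<a. avoid (p ` I) r (z r j)) = 0"
      using time[OF ij(1)] by (intro bexI[of _ "fst (p i)"]) simp_all
    then have "(\<Prod>r<T. \<Prod>j<a. avoid (p ` I) r (z r j)) = 0"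
      by (rule prod_zero[OF finite_lessThan])
    then show ?thesis using False by (simp only: of_bool_eq_0_iff simp_thms)
  qed
  then have "(\<Sum>z\<in>nip_to a T y. of_bool (\<forall>i\<in>I. \<not> (\<exists>j<a. z (fst (p i)) j = snd (p i)))) =
      det (mat a a (\<lambda>(j, i). walk_wt (avoid (p ` I)) T (2 * int i) (y j)))"
    using sum_nip_to_eq_det[where a = a and y = y and T = T and w = "avoid (p ` I)", OF assms(1-3)] by simp
  \<comment> \<open>\<open>sum_nip_to_eq_det\<close> indexes rows by end points,
    \<open>det_avoid\<close> by start points.\<close>
  also have "\<dots> = det (transpose_mat (mat a a (\<lambda>(j, i). walk_wt (avoid (p ` I)) T (2 * int i) (y j))))"
    by (rule det_transpose[OF mat_carrier, symmetric])
  also have "transpose_mat (mat a a (\<lambda>(j, i). walk_wt (avoid (p ` I)) T (2 * int i) (y j))) =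
      mat a a (\<lambda>(i, j). walk_wt (avoid (p ` I)) T (2 * int i) (y j))"
    by (rule eq_matI) auto
  finally show ?thesis .
qed

lemma det_zero_row:
  fixes f :: "nat \<Rightarrow> nat \<Rightarrow> real"
  assumes "i < k" "\<And>j. j < k \<Longrightarrow> f i j = 0"
  shows "det (mat k k (\<lambda>(i, j). f i j)) = 0"
  unfolding det_mat_leibniz
proof (intro sum.neutral ballI)
  fix q assume "q \<in> {q. q permutes {..<k}}"
  then have "q i < k" using permutes_in_image[of q "{..<k}" i] assms(1) by simp
  then have "(\<Prod>i<k. f i (q i)) = 0" using assms by (intro prod_zero bexI[of _ i]) auto
  then show "signof q * (\<Prod>i<k. f i (q i)) = 0" by simp
qed

theorem theorem3p1:
  fixes a b c k :: nat and p :: "nat \<Rightarrow> nat \<times> int"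
  assumes "0 < a" and "0 < b" and "0 < c" and "b \<le> c"
    and "inj_on p {..<k}"
    and "\<And>i. i < k \<Longrightarrow> 0 < fst (p i) \<and> fst (p i) < b + c"
  shows "corr_prob a b c k p =
         det (mat k k (\<lambda>(i, j). K_H a b c (fst (p i)) (snd (p i)) (fst (p j)) (snd (p j))))"
proof -
  let ?T = "b + c"
  let ?K = "\<lambda>i j. K_H a b c (fst (p i)) (snd (p i)) (fst (p j)) (snd (p j))"
  let ?occ = "\<lambda>z i. \<exists>j<a. z (fst (p i)) j = snd (p i)"
  define y :: "nat \<Rightarrow> int" where "y j = (if j < a then int c - int b + 2 * int j else 0)" for j
  have y: "\<And>j. a \<le> j \<Longrightarrow> y j = 0" "\<And>j. Suc j < a \<Longrightarrow> y j \<le> y (Suc j)" "\<And>j. j < a \<Longrightarrow> even (y j - int ?T)"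
    by (auto simp: y_def)
  have nip: "nip_families a b c = nip_to a ?T y"
    unfolding nip_families_def nip_to_def y_def by (rule Collect_cong) simp
  have fin: "finite (nip_to a ?T y)" using sum_nip_to_eq_det[where a = a and y = y and T = ?T, OF y] by blast
  show ?thesis
  \<comment> \<open>A point of wrong parity is never occupied and has a zero row in the kernel
    matrix, so both sides vanish. Otherwise \<open>K_H_eq\<close> applies to all entries.\<close>
  proof (cases "\<forall>i<k. even (snd (p i) - alpha_r a b c (fst (p i)))")
    case False
    then obtain i where i: "i < k" "odd (snd (p i) - alpha_r a b c (fst (p i)))" by blast
    have "\<not> ?occ z i" if "z \<in> nip_to a ?T y" for z
    proof
      assume "?occ z i"
      then have "even (snd (p i) - int (fst (p i)))"
        using nip_to_parity[OF that, of _ "fst (p i)"] assms(6)[OF i(1)] by (metis less_imp_le)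
      moreover have "even (alpha_r a b c (fst (p i)) - int (fst (p i)))" by (simp add: alpha_r_def)
      ultimately show False using i(2) by presburger
    qed
    then have none: "{z \<in> nip_families a b c. \<forall>i<k. ?occ z i} = {}" using i(1) nip by blast
    have "corr_prob a b c k p = 0" unfolding corr_prob_def none by simp
    moreover have "det (mat k k (\<lambda>(i, j). ?K i j)) = 0"
      using i by (intro det_zero_row[of i]) (auto simp: K_H_def)
    ultimately show ?thesis by simp
  next
    case True
    define A where "A i j = path_count ?T (y j - 2 * int i)" for i j
    define M where "M n i = hexE a b c n 0 (2 * int i)" for n i
    define N where "N n j = hexF a b c n ?T (int c - int b + 2 * int j)" for n j
    have E: "hexE a b c n s u = (\<Sum>i<a. M n i * path_count s (u - 2 * int i))" if "n < a" "s \<le> ?T" for n s u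
      using hexE_step[OF assms(4) that(1)] hexE_start[OF assms(1)] that(2)
      unfolding M_def by (rule forward_transport)
    have F: "hexF a b c n r u = (\<Sum>j<a. N n j * path_count (?T - r) (y j - u))" if "n < a" "r \<le> ?T" for n r u
    proof -
      have "hexF a b c n r u = (\<Sum>j<a. N n j * path_count (?T - r) (int c - int b + 2 * int j - u))"
        using hexF_step[OF assms(4) that(1)] hexF_end[OF assms(1,4,3)] that(2)
        unfolding N_def by (rule backward_transport)
      then show ?thesis by (simp add: y_def)
    qed
    \<comment> \<open>The inner sum is \<open>hexF\<close> transported back to time 0 at the start
      point 2i, so the pairing through path counts becomes the Hahn orthogonality there.\<close>
    have biorth: "hex_norm a b c n * (\<Sum>i<a. M n i * (\<Sum>j<a. A i j * N m j)) = of_bool (n = m)"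
      if "n < a" "m < a" for n m
      using hex_orthogonal[OF assms(4) that] F[OF that(2), of 0]
      by (simp add: M_def A_def mult.commute)
    have K: "?K l l' = - phi_rs (fst (p l)) (fst (p l')) (snd (p l)) (snd (p l')) +
        (\<Sum>n<a. hexF a b c n (fst (p l)) (snd (p l)) * hex_norm a b c n * hexE a b c n (fst (p l')) (snd (p l')))"
      if "l < k" "l' < k" for l l'
      using True that assms by (intro K_H_eq) (auto intro: less_imp_le)
    have time: "fst (p l) < ?T" if "l < k" for l using assms(6)[OF that] by simp
    let ?A = "mat a a (\<lambda>(i, j). A i j)"
    let ?D = "\<lambda>I. det (mat k k (\<lambda>(l, l'). of_bool (l = l') - (if l \<in> I then ?K l l' else 0)))"
    have A0: "det ?A \<noteq> 0"
      and D: "det (mat a a (\<lambda>(i, j). walk_wt (avoid (p ` I)) ?T (2 * int i) (y j))) = det ?A * ?D I"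
      if "I \<subseteq> {..<k}" for I
      unfolding A_def
      by (rule det_avoid[OF assms(5) time that biorth[unfolded A_def]
            E[OF _ less_imp_le[OF time]] F[OF _ less_imp_le[OF time]] K]; assumption)+
    have count: "(\<Sum>z\<in>nip_to a ?T y. of_bool (\<forall>i\<in>I. \<not> ?occ z i)) = det ?A * ?D I" if "I \<subseteq> {..<k}" for I
      using sum_nip_to_avoid_eq_det[where a = a and y = y and T = ?T and I = I and p = p, OF y] D[OF that] time that by auto
    have "?D {} = det (1\<^sub>m k)" by (intro arg_cong[where f = det] eq_matI) auto
    \<comment> \<open>The empty set of points gives the total number of families; this factor
      cancels in the quotient.\<close>
    then have "real (card (nip_to a ?T y)) = det ?A" using count[of "{}"] by simp
    moreover have "real (card {z \<in> nip_to a ?T y. \<forall>i<k. ?occ z i}) = det ?A * det (mat k k (\<lambda>(i, j). ?K i j))"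
    proof -
      have "real (card {z \<in> nip_to a ?T y. \<forall>i<k. ?occ z i}) = (\<Sum>z\<in>nip_to a ?T y. of_bool (\<forall>i\<in>{..<k}. ?occ z i))"
        using fin by (simp add: of_bool_def sum.If_cases Int_def Ball_def)
      also have "\<dots> = (\<Sum>z\<in>nip_to a ?T y. \<Sum>I\<in>Pow {..<k}. (-1) ^ card I * of_bool (\<forall>i\<in>I. \<not> ?occ z i))"
        by (rule sum.cong[OF refl], rule of_bool_ball_inclusion_exclusion) simp
      also have "\<dots> = (\<Sum>I\<in>Pow {..<k}. (-1) ^ card I * (\<Sum>z\<in>nip_to a ?T y. of_bool (\<forall>i\<in>I. \<not> ?occ z i)))"
        by (subst sum.swap) (simp only: sum_distrib_left)
      also have "\<dots> = (\<Sum>I\<in>Pow {..<k}. det ?A * ((-1) ^ card I * ?D I))"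
      proof (rule sum.cong[OF refl])
        fix I assume "I \<in> Pow {..<k}"
        then show "(-1) ^ card I * (\<Sum>z\<in>nip_to a ?T y. of_bool (\<forall>i\<in>I. \<not> ?occ z i)) = det ?A * ((-1) ^ card I * ?D I)"
          using count[of I] by (simp only: Pow_iff mult.left_commute)
      qed
      also have "\<dots> = det ?A * det (mat k k (\<lambda>(i, j). ?K i j))"
        by (simp only: sum_distrib_left[symmetric] sum_signed_rows)
      finally show ?thesis .
    qed
    ultimately show ?thesis using A0[of "{}"] unfolding corr_prob_def nip by simp
  qed
qed

end
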